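(* Let $K$ be a non-Archimedean local field of characteristic zero and let $E$ be either $K\times K$ or an unramified quadratic field extension of $K$. Then for every (non-degenerate) hermitian lattice $L$ over $E$, the unitary group $U(L)$ is generated by symmetries, i.e. $U(L)=S(L)$.
   Context: $K$ has valuation ring $\mathfrak{o}$ and maximal ideal $\mathfrak{p}$. $E$ is a $2$-dimensional étale $K$-algebra with non-trivial $K$-automorphism $x\mapsto\bar x$ (on $K\times K$ it is $(a,b)\mapsto(b,a)$), trace $\mathrm{Tr}(\alpha)=\alpha+\bar\alpha$ and norm $\mathrm{Nr}(\alpha)=\alpha\bar\alpha$. $\mathcal{O}$ is the integral closure of $\mathfrak{o}$ in $E$. A hermitian space is a finitely generated free $E$-module $V$ with a map $\langle\cdot,\cdot\rangle:V\times V\to E$, $E$-linear in the first argument, with $\langle x,y\rangle=\overline{\langle y,x\rangle}$. A hermitian lattice is a finitely generated $\mathcal{O}$-submodule $L$ of such a $V$; it is non-degenerate if no nonzero element of $L$ is orthogonal to all of $L$. $U(V)$ is the group of $E$-linear automorphisms of $V$ preserving the form and $U(L)=\{f\in U(V): f(L)=L\}$. For $s\in V$ and $\sigma\in E^\times$ with $\langle s,s\rangle=\mathrm{Tr}(\sigma)$, the symmetry $S_{s,\sigma}:V\to V$ is $x\mapsto x-\langle x,s\rangle\sigma^{-1}s$; it lies in $U(V)$. $S(L)$ denotes the subgroup of $U(L)$ generated by the symmetries that lie in $U(L)$.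
   Formalization: The ambient hermitian space V is also assumed non-degenerate (automatic when L spans V); otherwise the claim fails, e.g. V = E with zero form and L = 0, where U(L) = E^× but all symmetries are the identity. *)

theory Defs
  imports
    "HOL-Computational_Algebra.Polynomial"
    "HOL-Algebra.QuotRing"
    "HOL-Algebra.Generated_Groups"
begin

section \<open>Non-Archimedean local fields\<close>

text \<open>A subset of a commutative ring type, viewed as a ring of HOL-Algebra. It is only used for
  subsets that are subrings of the ambient ring.\<close>

definition subring_of_type :: "'a::comm_ring_1 set \<Rightarrow> 'a ring" where
  "subring_of_type A = \<lparr>carrier = A, mult = (*), one = 1, zero = 0, add = (+)\<rparr>"

text \<open>Valuations are integer valued, so the value at \<open>0\<close> (morally infinite) carries no
  information; every use of a valuation treats \<open>0\<close> separately.
  The set \<open>valuation_ge v n\<close> is the \<open>n\<close>-th power of the maximal ideal if \<open>n \<ge> 0\<close>.\<close>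

definition valuation_ge :: "('k::field \<Rightarrow> int) \<Rightarrow> int \<Rightarrow> 'k set" where
  "valuation_ge v n = {x. x = 0 \<or> v x \<ge> n}"

definition valuation_ring :: "('k::field \<Rightarrow> int) \<Rightarrow> 'k set" where
  "valuation_ring v = valuation_ge v 0"

definition valuation_ideal :: "('k::field \<Rightarrow> int) \<Rightarrow> 'k set" where
  "valuation_ideal v = valuation_ge v 1"

text \<open>A field that is complete with respect to a normalised discrete valuation and has finite
  residue field.\<close>

locale nonarch_local_field =
  fixes v :: "'k::field \<Rightarrow> int"
  assumes val_mult: "x \<noteq> 0 \<Longrightarrow> y \<noteq> 0 \<Longrightarrow> v (x * y) = v x + v y"
    and val_add: "x \<noteq> 0 \<Longrightarrow> y \<noteq> 0 \<Longrightarrow> x + y \<noteq> 0 \<Longrightarrow> v (x + y) \<ge> min (v x) (v y)"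
    and val_normalised: "\<exists>x. x \<noteq> 0 \<and> v x = 1"
    and val_complete:
      "\<And>X :: nat \<Rightarrow> 'k.
        \<forall>n. \<exists>N. \<forall>i\<ge>N. \<forall>j\<ge>N. X i - X j \<in> valuation_ge v n
        \<Longrightarrow> \<exists>l. \<forall>n. \<exists>N. \<forall>i\<ge>N. X i - l \<in> valuation_ge v n"
    and finite_residue_field:
      "finite (carrier (subring_of_type (valuation_ring v) Quot valuation_ideal v))"

section \<open>Quadratic algebras\<close>

text \<open>The commutative ring \<open>'e\<close> is a \<open>2\<close>-dimensional algebra over the field \<open>'k\<close> via the structure
  map \<open>\<iota>\<close>, and \<open>bar\<close> is a non-trivial \<open>'k\<close>-algebra automorphism of it.\<close>

locale quadratic_algebra =
  fixes \<iota> :: "'k::field \<Rightarrow> 'e::comm_ring_1"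
    and bar :: "'e \<Rightarrow> 'e"
  assumes emb_add: "\<iota> (a + b) = \<iota> a + \<iota> b"
    and emb_mult: "\<iota> (a * b) = \<iota> a * \<iota> b"
    and emb_one: "\<iota> 1 = 1"
    and dim_2: "vector_space.dim (\<lambda>a x. \<iota> a * x) UNIV = 2"
    and bar_bij: "bij bar"
    and bar_add: "bar (x + y) = bar x + bar y"
    and bar_mult: "bar (x * y) = bar x * bar y"
    and bar_emb: "bar (\<iota> a) = \<iota> a"
    and bar_nontrivial: "bar \<noteq> id"

definition trace :: "('e::comm_ring_1 \<Rightarrow> 'e) \<Rightarrow> 'e \<Rightarrow> 'e" where
  "trace bar \<alpha> = \<alpha> + bar \<alpha>"

text \<open>The algebra is isomorphic to \<open>K \<times> K\<close> with componentwise operations. As \<open>K \<times> K\<close> has no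
  non-trivial \<open>K\<close>-algebra automorphism except for the swap, \<open>bar\<close> need not be mentioned.\<close>

definition split_algebra :: "('k::field \<Rightarrow> 'e::comm_ring_1) \<Rightarrow> bool" where
  "split_algebra \<iota> \<longleftrightarrow>
    (\<exists>\<phi> :: 'e \<Rightarrow> 'k \<times> 'k. bij \<phi> \<and>
      (\<forall>x y. \<phi> (x + y) = (fst (\<phi> x) + fst (\<phi> y), snd (\<phi> x) + snd (\<phi> y))) \<and>
      (\<forall>x y. \<phi> (x * y) = (fst (\<phi> x) * fst (\<phi> y), snd (\<phi> x) * snd (\<phi> y))) \<and>
      (\<forall>a. \<phi> (\<iota> a) = (a, a)))"

definition integral_closure ::
    "('k::field \<Rightarrow> int) \<Rightarrow> ('k \<Rightarrow> 'e::comm_ring_1) \<Rightarrow> 'e set" where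
  "integral_closure v \<iota> =
    {x. \<exists>p :: 'k poly. lead_coeff p = 1 \<and> (\<forall>i. coeff p i \<in> valuation_ring v) \<and>
          poly (map_poly \<iota> p) x = 0}"

text \<open>A field extension is unramified if the maximal ideal of the base generates the maximal ideal of
  the integral closure (and the residue extension is separable, which is automatic as residue fields
  of local fields are finite).\<close>

definition unramified_field_extension ::
    "('k::field \<Rightarrow> int) \<Rightarrow> ('k \<Rightarrow> 'e::comm_ring_1) \<Rightarrow> bool" where
  "unramified_field_extension v \<iota> \<longleftrightarrow>
    (\<forall>x::'e. x \<noteq> 0 \<longrightarrow> (\<exists>y. x * y = 1)) \<and>
    (let R = subring_of_type (integral_closure v \<iota>)
     in maximalideal (genideal R (\<iota> ` valuation_ideal v)) R)"

section \<open>Hermitian spaces, lattices and symmetries\<close>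

locale hermitian_space = module scale
  for scale :: "'e::comm_ring_1 \<Rightarrow> 'v::ab_group_add \<Rightarrow> 'v" +
  fixes bar :: "'e \<Rightarrow> 'e"
    and form :: "'v \<Rightarrow> 'v \<Rightarrow> 'e"
  assumes finite_free: "\<exists>B. finite B \<and> independent B \<and> span B = UNIV"
    and form_linear: "module_hom scale (*) (\<lambda>x. form x y)"
    and form_hermitian: "form x y = bar (form y x)"

definition nondegenerate_on :: "('v \<Rightarrow> 'v \<Rightarrow> 'e::zero) \<Rightarrow> 'v::zero set \<Rightarrow> bool" where
  "nondegenerate_on form M \<longleftrightarrow> (\<forall>x\<in>M. (\<forall>y\<in>M. form x y = 0) \<longrightarrow> x = 0)"

definition fg_submodule ::
    "('e::comm_ring_1 \<Rightarrow> 'v::ab_group_add \<Rightarrow> 'v) \<Rightarrow> 'e set \<Rightarrow> 'v set \<Rightarrow> bool" where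
  "fg_submodule scale A L \<longleftrightarrow>
    (\<exists>S. finite S \<and> L = {(\<Sum>x\<in>S. scale (c x) x) |c. \<forall>x\<in>S. c x \<in> A})"

definition unitary_group ::
    "('e::comm_ring_1 \<Rightarrow> 'v::ab_group_add \<Rightarrow> 'v) \<Rightarrow> ('v \<Rightarrow> 'v \<Rightarrow> 'e) \<Rightarrow> ('v \<Rightarrow> 'v) set" where
  "unitary_group scale form =
    {f. module_hom scale scale f \<and> bij f \<and> (\<forall>x y. form (f x) (f y) = form x y)}"

definition lattice_unitary_group ::
    "('e::comm_ring_1 \<Rightarrow> 'v::ab_group_add \<Rightarrow> 'v) \<Rightarrow> ('v \<Rightarrow> 'v \<Rightarrow> 'e) \<Rightarrow> 'v set
      \<Rightarrow> ('v \<Rightarrow> 'v) monoid" where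
  "lattice_unitary_group scale form L =
    \<lparr>carrier = {f \<in> unitary_group scale form. f ` L = L}, mult = (\<circ>), one = id\<rparr>"

definition symmetry ::
    "('e::comm_ring_1 \<Rightarrow> 'v::ab_group_add \<Rightarrow> 'v) \<Rightarrow> ('v \<Rightarrow> 'v \<Rightarrow> 'e) \<Rightarrow> 'v \<Rightarrow> 'e \<Rightarrow> 'v \<Rightarrow> 'v" where
  "symmetry scale form s \<sigma> = (\<lambda>x. x - scale (form x s * (THE \<tau>. \<sigma> * \<tau> = 1)) s)"

definition symmetries ::
    "('e::comm_ring_1 \<Rightarrow> 'v::ab_group_add \<Rightarrow> 'v) \<Rightarrow> ('e \<Rightarrow> 'e) \<Rightarrow> ('v \<Rightarrow> 'v \<Rightarrow> 'e)
      \<Rightarrow> ('v \<Rightarrow> 'v) set" where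
  "symmetries scale bar form =
    {symmetry scale form s \<sigma> |s \<sigma>. \<sigma> dvd 1 \<and> form s s = trace bar \<sigma>}"

definition symmetry_subgroup ::
    "('e::comm_ring_1 \<Rightarrow> 'v::ab_group_add \<Rightarrow> 'v) \<Rightarrow> ('e \<Rightarrow> 'e) \<Rightarrow> ('v \<Rightarrow> 'v \<Rightarrow> 'e) \<Rightarrow> 'v set
      \<Rightarrow> ('v \<Rightarrow> 'v) set" where
  "symmetry_subgroup scale bar form L =
    generate (lattice_unitary_group scale form L)
      (symmetries scale bar form \<inter> carrier (lattice_unitary_group scale form L))"

end

theory Submission
  imports Defs
begin

text \<open>Let \<open>R\<close> be the integral closure. It is self-dual for the trace form, so a vector \<open>x\<close> of \<open>L\<close>
  whose norm \<open>a\<close> has minimal valuation among all traces \<open>Tr \<langle>y, z\<rangle>\<close> generates the scale of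
  \<open>L\<close>; hence \<open>L = R x \<bottom> L'\<close>. If \<open>y\<close> in \<open>L\<close> also has norm \<open>a\<close>, then \<open>y\<close> is mapped to \<open>x\<close> by
  symmetries \<open>S\<^bsub>s,\<sigma>\<^esub>\<close> with \<open>s\<close> in \<open>L\<close> and \<open>\<sigma>/a\<close> a unit of \<open>R\<close>, which preserve \<open>L\<close>: in the field
  case by one symmetry, possibly after scaling \<open>y\<close> by an element of norm 1, and in the split case
  by three elementary transformations. So an element of \<open>U(L)\<close> can be reduced, along an orthogonal
  basis, to one that fixes \<open>L\<close> pointwise. The same argument with the whole algebra in place of \<open>R\<close>
  applies to the orthogonal complement of \<open>L\<close>.\<close>

section \<open>Rings with conjugation\<close>

text \<open>The difficulty is residue characteristic 2, where 2 cannot be divided out. Three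
  properties of \<open>R\<close> replace that division. Self-duality turns minimality of traces into
  divisibility of all values of the form. Locality of the fixed elements makes one of
  \<open>y\<close>, \<open>z\<close>, \<open>y + z\<close> have a norm of minimal valuation as soon
  as the trace of \<open>form y z\<close> does. In the field case a unit of trace 1 takes over the
  role of 1/2. The split algebra is not local: an element can be a unit in one component and a
  non-unit in the other, so the argument by a single symmetry breaks down. Instead the form pairs
  the two components of a vector with each other, so that they can be corrected separately; two of
  the three transformations are along isotropic vectors, with \<open>\<sigma>\<close> a unit
  multiple of \<open>a\<close> of trace 0, and \<open>2 * e - 1\<close> supplies such a unit. As
  \<open>L\<close> need not span the space, fixing \<open>L\<close> pointwise is not the end.
  Symmetries along vectors orthogonal to \<open>L\<close> fix \<open>L\<close> pointwise, so no
  integrality restricts them; this is why the complement can be treated over the whole algebra and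
  why \<open>R\<close> is abstract.\<close>

text \<open>The ring \<open>R\<close> is the integral closure or the whole algebra; in the second case
  the valuation \<open>w\<close> of the fixed elements is trivial.\<close>

locale conjugation_order =
  fixes bar :: "'e::comm_ring_1 \<Rightarrow> 'e" and R :: "'e set" and w :: "'e \<Rightarrow> int"
  assumes bar_add: "bar (x + y) = bar x + bar y"
    and bar_mult: "bar (x * y) = bar x * bar y"
    and bar_bar: "bar (bar x) = x"
    and one_mem: "1 \<in> R"
    and add_mem: "x \<in> R \<Longrightarrow> y \<in> R \<Longrightarrow> x + y \<in> R"
    and uminus_mem: "x \<in> R \<Longrightarrow> - x \<in> R"
    and mult_mem: "x \<in> R \<Longrightarrow> y \<in> R \<Longrightarrow> x * y \<in> R"
    and bar_mem: "x \<in> R \<Longrightarrow> bar x \<in> R"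
    and fixed_invertible: "bar x = x \<Longrightarrow> x \<noteq> 0 \<Longrightarrow> \<exists>y. x * y = 1"
    and fixed_dvd: "bar x = x \<Longrightarrow> bar y = y \<Longrightarrow> x \<noteq> 0 \<Longrightarrow> y \<noteq> 0 \<Longrightarrow> w x \<le> w y \<Longrightarrow> \<exists>c\<in>R. y = c * x"
    and fixed_local: "bar x = x \<Longrightarrow> x \<in> R \<Longrightarrow> (\<exists>y\<in>R. x * y = 1) \<or> (\<exists>y\<in>R. (1 - x) * y = 1)"
    and trace_dual: "(\<And>a. a \<in> R \<Longrightarrow> a * x + bar (a * x) \<in> R) \<Longrightarrow> x \<in> R"
    and trace_nondeg: "(\<And>a. a \<in> R \<Longrightarrow> a * x + bar (a * x) = 0) \<Longrightarrow> x = 0"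
    and split_or_local: "(\<exists>e\<in>R. e * e = e \<and> bar e = 1 - e) \<or>
      (\<exists>u\<in>R. (\<exists>u'\<in>R. u * u' = 1) \<and> u + bar u = 1 \<and>
        (\<forall>t\<in>R. (\<exists>y\<in>R. t * y = 1) \<or> (\<exists>y\<in>R. (1 - t) * y = 1)))"
begin

lemma zero_mem: "0 \<in> R"
  using add_mem[OF one_mem uminus_mem[OF one_mem]] by simp

lemma diff_mem: "x \<in> R \<Longrightarrow> y \<in> R \<Longrightarrow> x - y \<in> R"
  using add_mem[OF _ uminus_mem, of x y] by simp

lemma bar_0 [simp]: "bar 0 = 0"
  using bar_add[of 0 0] by simp

lemma bar_uminus: "bar (- x) = - bar x"
  using bar_add[of x "- x"] by (simp add: eq_neg_iff_add_eq_0 add.commute)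

lemma bar_diff: "bar (x - y) = bar x - bar y"
  using bar_add[of x "- y"] by (simp add: bar_uminus)

lemma bar_1 [simp]: "bar 1 = 1"
  using bar_mult[of "bar 1" 1] by (simp add: bar_bar)

lemmas bar_simps = bar_add bar_mult bar_bar bar_uminus bar_diff
lemmas mem_intros = one_mem zero_mem add_mem uminus_mem mult_mem bar_mem diff_mem

lemma bar_inverse:
  assumes "x * y = 1"
  shows "bar x * bar y = 1"
  using assms by (metis bar_1 bar_mult)

lemma fixed_inverse:
  assumes "x * y = 1" "bar x = x"
  shows "bar y = y"
  using assms by (metis bar_inverse mult.assoc mult.commute mult_1)

definition units :: "'e set" where
  "units = {x \<in> R. \<exists>y\<in>R. x * y = 1}"

lemma unitsI: "x \<in> R \<Longrightarrow> y \<in> R \<Longrightarrow> x * y = 1 \<Longrightarrow> x \<in> units"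
  by (auto simp: units_def)

lemma units_mult: "x \<in> units \<Longrightarrow> y \<in> units \<Longrightarrow> x * y \<in> units"
  unfolding units_def
proof (safe intro!: mult_mem)
  fix y' x' assume "y * y' = 1" "x * x' = 1" "x' \<in> R" "y' \<in> R"
  moreover have "x * y * (x' * y') = (x * x') * (y * y')"
    by (simp add: algebra_simps)
  ultimately show "\<exists>z\<in>R. x * y * z = 1"
    by (intro bexI[of _ "x' * y'"]) (auto intro: mult_mem)
qed

lemma units_mult_left:
  assumes "x * y \<in> units" "x \<in> R" "y \<in> R"
  shows "x \<in> units"
  using assms unfolding units_def by (auto simp: mult.assoc intro: mult_mem)

lemma units_uminus_iff [simp]: "- x \<in> units \<longleftrightarrow> x \<in> units"
  unfolding units_def using uminus_mem[of x] uminus_mem[of "- x"]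
  by auto (metis minus_mult_minus uminus_mem minus_minus mult_minus_left mult_minus_right)+

lemma fixed_units_cases: "bar x = x \<Longrightarrow> x \<in> R \<Longrightarrow> x \<in> units \<or> 1 - x \<in> units"
  using fixed_local[of x] by (auto simp: units_def intro: mem_intros)

text \<open>Locality in the form that polarisation requires: if \<open>z\<close> is the inverse of
  the unit \<open>1 + x\<close>, then \<open>y * z\<close> is still a non-unit, and the sum is the
  product of the units \<open>1 + x\<close> and \<open>1 + y * z\<close>. Only fixed elements are
  covered, because \<open>R\<close> itself is not local in the split case.\<close>

lemma fixed_nonunits_add:
  assumes x: "bar x = x" "x \<in> R" "x \<notin> units" and y: "bar y = y" "y \<in> R" "y \<notin> units"
  shows "x + y + 1 \<in> units"
proof -
  have "1 - (- x) \<in> units"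
    using fixed_units_cases[of "- x"] x by (auto simp: bar_simps mem_intros)
  then obtain z where z: "z \<in> R" "(1 + x) * z = 1"
    by (auto simp: units_def)
  have bz: "bar z = z"
    using fixed_inverse[OF z(2)] x by (simp add: bar_simps)
  have "- (y * z) \<notin> units"
    using units_mult_left[of y z] y z by auto
  then have "1 - (- (y * z)) \<in> units"
    using fixed_units_cases[of "- (y * z)"] y z bz by (auto simp: bar_simps mem_intros)
  moreover have "1 + x \<in> units"
    using x z by (auto intro!: unitsI[of _ z] mem_intros)
  ultimately have "(1 + x) * (1 + y * z) \<in> units"
    using units_mult by simp
  moreover have "(1 + x) * (1 + y * z) = 1 + x + y * ((1 + x) * z)"
    by (simp add: algebra_simps)
  then have "(1 + x) * (1 + y * z) = x + y + 1"
    by (simp add: z(2))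
  ultimately show ?thesis
    by simp
qed

end

section \<open>Hermitian spaces over rings with conjugation\<close>

locale hermitian_order = hermitian_space scale bar form + conjugation_order bar R w
  for scale :: "'e::comm_ring_1 \<Rightarrow> 'v::ab_group_add \<Rightarrow> 'v" (infixr \<open>*s\<close> 75)
    and bar :: "'e \<Rightarrow> 'e" and form :: "'v \<Rightarrow> 'v \<Rightarrow> 'e" and R :: "'e set" and w :: "'e \<Rightarrow> int"
begin

lemma form_add_left: "form (x + y) z = form x z + form y z"
  using form_linear by (rule module_hom.add)

lemma form_scale_left: "form (a *s x) z = a * form x z"
  using form_linear by (rule module_hom.scale)

lemma form_add_right: "form z (x + y) = form z x + form z y"
  by (metis form_hermitian form_add_left bar_add)

lemma form_scale_right: "form z (a *s x) = bar a * form z x"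
  by (metis form_hermitian form_scale_left bar_mult)

lemma form_zero_left [simp]: "form 0 x = 0"
  using form_scale_left[of 0 0 x] by simp

lemma form_minus_left: "form (- x) y = - form x y"
  using form_scale_left[of "- 1" x y] by simp

lemma form_minus_right: "form y (- x) = - form y x"
  using form_scale_right[of y "- 1" x] by (simp add: bar_uminus)

lemma form_diff_left: "form (x - y) z = form x z - form y z"
  using form_add_left[of x "- y" z] by (simp add: form_minus_left)

lemma form_diff_right: "form z (x - y) = form z x - form z y"
  using form_add_right[of z x "- y"] by (simp add: form_minus_right)

lemma form_sum_left: "form (\<Sum>i\<in>I. g i) z = (\<Sum>i\<in>I. form (g i) z)"
  by (induction I rule: infinite_finite_induct) (auto simp: form_add_left)

lemma form_self_fixed: "bar (form x x) = form x x"
  using form_hermitian[of x x] by simp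

lemmas form_simps = form_add_left form_add_right form_scale_left form_scale_right
  form_diff_left form_diff_right form_minus_left form_minus_right

section \<open>Symmetries: isometry, inverse, invariant submodules\<close>

lemma symmetry_eq:
  assumes "\<sigma> * \<tau> = 1"
  shows "symmetry scale form s \<sigma> = (\<lambda>x. x - (form x s * \<tau>) *s s)"
proof -
  have "(THE \<tau>. \<sigma> * \<tau> = 1) = \<tau>"
    using assms by (intro the_equality) (auto, metis mult.commute mult.left_commute mult_1)
  then show ?thesis
    by (simp add: symmetry_def)
qed

lemma symmetry_isometry:
  assumes "\<sigma> * \<tau> = 1" "form s s = trace bar \<sigma>"
  shows "form (symmetry scale form s \<sigma> x) (symmetry scale form s \<sigma> y) = form x y"
proof -
  have b: "bar \<sigma> * bar \<tau> = 1"
    using assms(1) by (rule bar_inverse)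
  have "form (symmetry scale form s \<sigma> x) (symmetry scale form s \<sigma> y)
      = form x y - form x s * form s y * (bar \<tau> + \<tau> - \<tau> * bar \<tau> * form s s)"
    unfolding symmetry_eq[OF assms(1)] form_simps bar_mult form_hermitian[of s y, symmetric]
    by (simp add: algebra_simps)
  \<comment> \<open>The condition \<open>form s s = trace bar \<sigma>\<close> multiplied by the
    norm of \<open>\<tau>\<close>.\<close>
  moreover have "\<tau> * bar \<tau> * form s s = bar \<tau> + \<tau>"
  proof -
    have "\<tau> * bar \<tau> * form s s = \<sigma> * \<tau> * bar \<tau> + bar \<sigma> * bar \<tau> * \<tau>"
      unfolding assms(2) trace_def by (simp add: algebra_simps)
    then show ?thesis
      using assms(1) b by simp
  qed
  ultimately show ?thesis
    by simp
qed

text \<open>The inverse is again a symmetry, with \<open>bar \<sigma>\<close> in place of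
  \<open>\<sigma>\<close>. Hence the conditions for mapping a submodule onto itself come in pairs,
  one with \<open>\<tau>\<close> and one with \<open>bar \<tau>\<close>.\<close>

lemma symmetry_symmetry:
  assumes "\<sigma> * \<tau> = 1" "form s s = trace bar \<sigma>"
  shows "symmetry scale form s (bar \<sigma>) (symmetry scale form s \<sigma> x) = x"
proof -
  have b: "bar \<sigma> * bar \<tau> = 1"
    using assms(1) by (rule bar_inverse)
  have "\<tau> + bar \<tau> - \<tau> * bar \<tau> * form s s
      = \<tau> * (1 - bar \<sigma> * bar \<tau>) + bar \<tau> * (1 - \<sigma> * \<tau>)"
    unfolding assms(2) trace_def by (simp add: algebra_simps)
  then have c: "\<tau> + bar \<tau> - \<tau> * bar \<tau> * form s s = 0"
    using assms(1) b by simp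
  have "symmetry scale form s (bar \<sigma>) (symmetry scale form s \<sigma> x)
      = x - (form x s * (\<tau> + bar \<tau> - \<tau> * bar \<tau> * form s s)) *s s"
    unfolding symmetry_eq[OF assms(1)] symmetry_eq[OF b] form_simps by (simp add: algebra_simps)
  then show ?thesis
    by (simp add: c)
qed

lemma trace_bar: "trace bar (bar \<sigma>) = trace bar \<sigma>"
  by (simp add: trace_def bar_bar add.commute)

lemma symmetry_unitary:
  assumes "\<sigma> * \<tau> = 1" "form s s = trace bar \<sigma>"
  shows "symmetry scale form s \<sigma> \<in> unitary_group scale form"
proof -
  have "module_hom scale scale (symmetry scale form s \<sigma>)"
    unfolding symmetry_eq[OF assms(1)]
    by unfold_locales (simp_all add: form_simps algebra_simps)
  moreover have "bij (symmetry scale form s \<sigma>)"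
  proof (rule o_bij)
    show "symmetry scale form s (bar \<sigma>) \<circ> symmetry scale form s \<sigma> = id"
      using symmetry_symmetry[OF assms] by auto
    show "symmetry scale form s \<sigma> \<circ> symmetry scale form s (bar \<sigma>) = id"
      using symmetry_symmetry[OF bar_inverse[OF assms(1)]] assms(2) by (auto simp: bar_bar trace_bar)
  qed
  ultimately show ?thesis
    using symmetry_isometry[OF assms] by (auto simp: unitary_group_def)
qed

lemma symmetry_image:
  assumes st: "\<sigma> * \<tau> = 1" "form s s = trace bar \<sigma>"
    and M: "\<And>x y. x \<in> M \<Longrightarrow> y \<in> M \<Longrightarrow> x + y \<in> M" "\<And>c x. c \<in> R \<Longrightarrow> x \<in> M \<Longrightarrow> c *s x \<in> M"
    and s: "\<And>z. z \<in> M \<Longrightarrow> (form z s * \<tau>) *s s \<in> M"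
      "\<And>z. z \<in> M \<Longrightarrow> (form z s * bar \<tau>) *s s \<in> M"
  shows "symmetry scale form s \<sigma> ` M = M"
proof -
  have M_diff: "x - y \<in> M" if "x \<in> M" "y \<in> M" for x y
    using M(1)[OF that(1) M(2)[OF uminus_mem[OF one_mem] that(2)]] by simp
  have b: "bar \<sigma> * bar \<tau> = 1"
    using st(1) by (rule bar_inverse)
  have 1: "symmetry scale form s \<sigma> z \<in> M" "symmetry scale form s (bar \<sigma>) z \<in> M" if "z \<in> M" for z
    using that s M_diff by (auto simp: symmetry_eq[OF st(1)] symmetry_eq[OF b])
  moreover have "z = symmetry scale form s \<sigma> (symmetry scale form s (bar \<sigma>) z)" for z
    using symmetry_symmetry[OF b, of s z] st(2) by (simp add: bar_bar trace_bar)
  ultimately show ?thesis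
    by (metis (no_types, lifting) image_subset_iff subsetI subset_antisym imageI)
qed

end

definition (in module) submodule_over :: "'a set \<Rightarrow> 'b set \<Rightarrow> bool" where
  "submodule_over A M \<longleftrightarrow> (\<forall>x\<in>M. \<forall>y\<in>M. x + y \<in> M) \<and> (\<forall>c\<in>A. \<forall>x\<in>M. scale c x \<in> M)"

context hermitian_order
begin

lemma submodule_add: "submodule_over R M \<Longrightarrow> x \<in> M \<Longrightarrow> y \<in> M \<Longrightarrow> x + y \<in> M"
  by (simp add: submodule_over_def)

lemma submodule_scale: "submodule_over R M \<Longrightarrow> c \<in> R \<Longrightarrow> x \<in> M \<Longrightarrow> c *s x \<in> M"
  by (simp add: submodule_over_def)

lemma submodule_diff: "submodule_over R M \<Longrightarrow> x \<in> M \<Longrightarrow> y \<in> M \<Longrightarrow> x - y \<in> M"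
  using submodule_add[of M x "- 1 *s y"] submodule_scale[of M "- 1" y]
  by (simp add: one_mem uminus_mem)

lemma submodule_sum:
  assumes "submodule_over R M" "0 \<in> M" "\<And>i. i \<in> I \<Longrightarrow> g i \<in> M"
  shows "(\<Sum>i\<in>I. g i) \<in> M"
  using assms(3)
  by (induction I rule: infinite_finite_induct) (auto simp: assms(2) intro: submodule_add[OF assms(1)])

text \<open>The two integrality conditions make the symmetry and its inverse map \<open>M\<close>
  into \<open>M\<close>, so that the image is all of \<open>M\<close>.\<close>

definition admissible :: "'v set \<Rightarrow> 'v \<Rightarrow> 'e \<Rightarrow> bool" where
  "admissible M s \<sigma> \<longleftrightarrow> s \<in> M \<and> form s s = trace bar \<sigma> \<and>
    (\<exists>\<tau>. \<sigma> * \<tau> = 1 \<and> (\<forall>z\<in>M. form z s * \<tau> \<in> R \<and> form z s * bar \<tau> \<in> R))"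

lemma admissible_image:
  assumes "submodule_over R M" "admissible M s \<sigma>"
  shows "symmetry scale form s \<sigma> ` M = M"
proof -
  obtain \<tau> where t: "\<sigma> * \<tau> = 1" "\<And>z. z \<in> M \<Longrightarrow> form z s * \<tau> \<in> R \<and> form z s * bar \<tau> \<in> R"
    and s: "s \<in> M" "form s s = trace bar \<sigma>"
    using assms(2) by (auto simp: admissible_def)
  show ?thesis
    using t(2) s(1) assms(1)
    by (intro symmetry_image[OF t(1) s(2)]) (auto intro: submodule_add submodule_scale)
qed

end

text \<open>A vector \<open>x\<close> of \<open>M\<close> whose norm \<open>a\<close> generates the scale of \<open>M\<close>.\<close>

locale scale_vector = hermitian_order +
  fixes M x a a'
  assumes sub: "submodule_over R M"
    and x_mem: "x \<in> M"
    and form_x: "form x x = a"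
    and a_inv: "a * a' = 1"
    and scale_le: "\<And>y z. y \<in> M \<Longrightarrow> z \<in> M \<Longrightarrow> form y z * a' \<in> R"
begin

lemmas M_intros = submodule_add[OF sub] submodule_scale[OF sub] submodule_diff[OF sub] x_mem

lemma bar_a: "bar a = a"
  using form_self_fixed[of x] by (simp add: form_x)

lemma bar_a': "bar a' = a'"
  using fixed_inverse[OF a_inv bar_a] .

lemma form_cancel: "form y z = a * (form y z * a')"
  using a_inv by (simp add: algebra_simps) (metis mult.commute mult_1 mult.assoc)

text \<open>All values of the form on \<open>M\<close> are divisible by \<open>a\<close>, so the
  factor \<open>a\<close> of \<open>\<sigma> = a * \<rho>\<close> is harmless and only
  \<open>\<rho>\<close> has to be a unit of \<open>R\<close>.\<close>

lemma
  assumes s: "s \<in> M" "\<rho> \<in> R" "\<rho>' \<in> R" "\<rho> * \<rho>' = 1" "form s s = a * (\<rho> + bar \<rho>)"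
  shows admissible_unit: "admissible M s (a * \<rho>)"
    and symmetry_unit: "symmetry scale form s (a * \<rho>) = (\<lambda>z. z - (form z s * a' * \<rho>') *s s)"
proof -
  have i: "(a * \<rho>) * (a' * \<rho>') = 1"
    using a_inv s(4) by (metis mult.assoc mult.left_commute mult_1)
  then show "symmetry scale form s (a * \<rho>) = (\<lambda>z. z - (form z s * a' * \<rho>') *s s)"
    by (simp add: symmetry_eq mult.assoc)
  have "form z s * (a' * \<rho>') \<in> R \<and> form z s * bar (a' * \<rho>') \<in> R" if "z \<in> M" for z
    using mult_mem[OF scale_le[OF that s(1)] s(3)]
      mult_mem[OF scale_le[OF that s(1)] bar_mem[OF s(3)]]
    by (simp add: bar_mult bar_a' mult.assoc)
  then show "admissible M s (a * \<rho>)"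
    using i s unfolding admissible_def
    by (intro conjI exI[of _ "a' * \<rho>'"]) (auto simp: trace_def bar_mult bar_a distrib_left)
qed

text \<open>For \<open>s = y - x\<close> and \<open>\<sigma> = form y s\<close> the symmetry
  subtracts exactly \<open>s\<close> from \<open>y\<close>. As \<open>x\<close> and \<open>y\<close>
  have the same norm, \<open>form s s\<close> is automatically the trace of \<open>\<sigma>\<close>;
  what remains is that \<open>\<sigma>\<close> divided by \<open>a\<close> is a unit.\<close>

lemma move_direct:
  assumes y: "y \<in> M" "form y y = a" and u: "1 - form y x * a' \<in> units"
  shows "\<exists>\<sigma>. admissible M (y - x) \<sigma> \<and> symmetry scale form (y - x) \<sigma> y = x"
proof -
  define \<rho> where "\<rho> = 1 - form y x * a'"
  obtain \<rho>' where r: "\<rho> \<in> R" "\<rho>' \<in> R" "\<rho> * \<rho>' = 1"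
    using u by (auto simp: units_def \<rho>_def)
  have ar: "a * \<rho> = a - form y x"
    using form_cancel[of y x] by (simp add: \<rho>_def algebra_simps)
  have "bar (a * \<rho>) = a - form x y"
    unfolding ar by (simp add: bar_diff bar_a flip: form_hermitian)
  then have "a * bar \<rho> = a - form x y"
    by (simp add: bar_mult bar_a)
  then have "form (y - x) (y - x) = a * (\<rho> + bar \<rho>)"
    using ar by (simp add: distrib_left form_simps y form_x)
  note 1 = M_intros(3)[OF y(1) x_mem] r this
  have "form y (y - x) = a * \<rho>"
    using ar by (simp add: form_simps y)
  then have "form y (y - x) * a' * \<rho>' = (a * a') * (\<rho> * \<rho>')"
    by (simp add: algebra_simps)
  then have "form y (y - x) * a' * \<rho>' = 1"
    by (simp add: a_inv r)
  then show ?thesis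
    using admissible_unit[OF 1] symmetry_unit[OF 1] by (intro exI[of _ "a * \<rho>"]) simp
qed

end

text \<open>\<open>H\<close> is kept abstract because it will be cut down to those elements of the
  symmetry group that fix the vectors treated before.\<close>

locale symmetry_closed = scale_vector +
  fixes H
  assumes H_admissible: "\<And>s \<sigma>. admissible M s \<sigma> \<Longrightarrow> symmetry scale form s \<sigma> \<in> H"
    and H_comp: "\<And>f g. f \<in> H \<Longrightarrow> g \<in> H \<Longrightarrow> f \<circ> g \<in> H"
begin

lemma admissible_step:
  assumes "admissible M s \<sigma>" "y \<in> M"
  shows "symmetry scale form s \<sigma> y \<in> M"
    and "form (symmetry scale form s \<sigma> y) (symmetry scale form s \<sigma> y) = form y y"
  using admissible_image[OF sub assms(1)] assms
  by (auto simp: admissible_def intro: symmetry_isometry)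

text \<open>If \<open>\<sigma> = \<langle>y, y - x\<rangle>\<close> is not admissible, then it becomes so after multiplying \<open>y\<close>
  by \<open>1 - 1/u\<close>, which is an element of norm 1 as \<open>u\<close> has trace 1.\<close>

lemma transitive_local:
  assumes u: "u \<in> units" "u + bar u = 1"
    and loc: "\<And>t. t \<in> R \<Longrightarrow> t \<in> units \<or> 1 - t \<in> units"
    and y: "y \<in> M" "form y y = a"
  shows "\<exists>h\<in>H. h y = x"
proof (cases "1 - form y x * a' \<in> units")
  case True
  then show ?thesis
    using move_direct[OF y True] H_admissible by blast
next
  case False
  interpret y: scale_vector scale bar form R w M y a a'
    by unfold_locales (use y sub a_inv scale_le in auto)
  define c where "c = form y x * a'"
  have c: "c \<in> R"
    using scale_le[OF y(1) x_mem] by (simp add: c_def)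
  obtain u' where u': "u \<in> R" "u' \<in> R" "u * u' = 1"
    using u by (auto simp: units_def)
  have "form y y = a * (u + bar u)"
    using y u by simp
  note 1 = y(1) u' this
  define y' where "y' = symmetry scale form y (a * u) y"
  have y'_eq: "y' = (1 - u') *s y"
    using symmetry_unit[OF 1] by (simp add: y'_def y a_inv scale_left_diff_distrib)
  have y': "y' \<in> M" "form y' y' = a"
    using admissible_step[OF admissible_unit[OF 1] y(1)] y by (auto simp: y'_def)
  have "1 - form y' x * a' = 1 - (1 - u') * c"
    by (simp add: y'_eq form_simps c_def algebra_simps)
  moreover have "1 - (1 - u') * c \<in> units"
  proof -
    \<comment> \<open>Chosen so that \<open>1 - t\<close> is \<open>u\<close> times the element in
      question. Since \<open>1 - c\<close> divides \<open>t\<close> and is a non-unit,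
      \<open>t\<close> is a non-unit, and locality makes \<open>1 - t\<close> a unit.\<close>
    define t where "t = - ((u - 1) * (1 - c))"
    have "1 - t = u * (1 - (1 - u') * c) - (u * u' - 1) * c"
      by (simp add: t_def algebra_simps)
    then have t: "1 - t = u * (1 - (1 - u') * c)"
      using u' by simp
    have "t \<notin> units"
    proof
      assume "t \<in> units"
      then have "(1 - c) * (u - 1) \<in> units"
        by (simp add: t_def mult.commute)
      then show False
        using units_mult_left[of "1 - c" "u - 1"] u' c False by (auto simp: c_def[symmetric] mem_intros)
    qed
    moreover have "t \<in> R"
      using u' c by (auto simp: t_def mem_intros)
    ultimately have "(1 - (1 - u') * c) * u \<in> units"
      using loc[of t] t by (simp add: mult.commute)
    then show ?thesis
      by (rule units_mult_left) (use u' c in \<open>auto simp: mem_intros\<close>)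
  qed
  ultimately obtain \<sigma> where s: "admissible M (y' - x) \<sigma>" "symmetry scale form (y' - x) \<sigma> y' = x"
    using move_direct[OF y'] by auto
  then have "symmetry scale form (y' - x) \<sigma> \<circ> symmetry scale form y (a * u) \<in> H"
    by (intro H_comp H_admissible) (use admissible_unit[OF 1] in auto)
  then show ?thesis
    using s by (intro bexI) (auto simp: y'_def)
qed

section \<open>Transitivity in the split case\<close>

context
  fixes e
  assumes e: "e \<in> R" "e * e = e" "bar e = 1 - e"
begin

lemma e_bar: "e * (1 - e) = 0" "(1 - e) * (1 - e) = 1 - e"
  using e by (simp_all add: algebra_simps)

text \<open>\<open>2 * e - 1\<close> is a unit of trace 0, even when 2 is not invertible; it serves
  as \<open>\<sigma>\<close> divided by \<open>a\<close>, up to sign, for isotropic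
  \<open>s\<close>.\<close>

lemma split_invertible: "(e - (1 - e)) * (e - (1 - e)) = 1"
proof -
  have "(e - (1 - e)) * (e - (1 - e)) = 4 * (e * e - e) + 1"
    by (simp add: algebra_simps)
  then show ?thesis
    using e by simp
qed

text \<open>The second component of \<open>s\<close> is the required correction
  \<open>y - x\<close>. Its first component is that of \<open>x\<close>, so that pairing with
  \<open>y\<close> gives \<open>(1 - e) * a\<close>: the symmetry then changes only the second
  component of \<open>y\<close>. The equality of first components makes \<open>s\<close>
  isotropic.\<close>

lemma split_third:
  assumes y: "y \<in> M" "form y y = a" "e *s y = e *s x"
  shows "\<exists>h\<in>H. h y = x"
proof -
  define s where "s = e *s x + (1 - e) *s (y - x)"
  have s: "s \<in> M"
    using e y by (auto simp: s_def intro!: M_intros mem_intros)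
  have 1: "e * form x z = e * form y z" for z
    using y(3) by (metis form_scale_left)
  have 2: "(1 - e) * form z x = (1 - e) * form z y" for z
    using y(3) e by (metis form_scale_right)
  have ee: "e * (e * z) = e * z" for z
    using e by (simp flip: mult.assoc)
  have xy: "e * form x y = e * a" "(1 - e) * form y x = (1 - e) * a"
    using 1[of y] 2[of y] y by simp_all
  have ys: "form y s = (1 - e) * a"
  proof -
    have "form y s = (1 - e) * form y x + e * (form y y - form y x)"
      by (simp add: s_def form_simps e bar_diff)
    moreover have "e * form y x = e * a"
      using 1[of x] form_x by simp
    ultimately show ?thesis
      using xy y by (simp add: algebra_simps)
  qed
  have "form x s = (1 - e) * a + e * (form x y - a)"
    by (simp add: s_def form_simps e bar_diff form_x algebra_simps)
  then have xs: "form x s = (1 - e) * a"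
    using xy by (simp add: algebra_simps)
  have "form s s = e * form x s + (1 - e) * (form y s - form x s)"
    by (subst s_def) (simp add: form_simps)
  also have "\<dots> = (e * (1 - e)) * a"
    unfolding xs ys by (simp add: mult.assoc)
  finally have "form s s = 0"
    by (simp add: e_bar)
  moreover have "(1 - e - e) + bar (1 - e - e) = 0"
    unfolding bar_diff bar_1 e(3) by simp
  moreover have "(1 - e - e) * (1 - e - e) = 1"
    using split_invertible by (simp add: algebra_simps)
  ultimately have sym: "s \<in> M" "1 - e - e \<in> R" "1 - e - e \<in> R" "(1 - e - e) * (1 - e - e) = 1"
    "form s s = a * ((1 - e - e) + bar (1 - e - e))"
    using s diff_mem[OF diff_mem[OF one_mem e(1)] e(1)] by (simp_all only: mult_zero_right)
  have "form y s * a' * (1 - e - e) = (a * a') * ((1 - e) * (1 - e) - e * (1 - e))"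
    unfolding ys by (simp add: algebra_simps)
  then have "form y s * a' * (1 - e - e) = 1 - e"
    by (simp add: a_inv e_bar)
  then have "symmetry scale form s (a * (1 - e - e)) y = y - (1 - e) *s s"
    using symmetry_unit[OF sym] by simp
  also have "\<dots> = y - (((1 - e) * e) *s x + ((1 - e) * (1 - e)) *s (y - x))"
    by (simp add: s_def scale_right_distrib)
  also have "\<dots> = y - (1 - e) *s (y - x)"
    using e_bar by (simp add: mult.commute)
  also have "\<dots> = x + (e *s y - e *s x)"
    by (simp add: algebra_simps)
  finally show ?thesis
    using y(3) H_admissible[OF admissible_unit[OF sym]] by (intro bexI) auto
qed

text \<open>Now the correction \<open>y - x\<close> is the first component of \<open>s\<close>, and
  its second component is that of \<open>x\<close>. The first component of \<open>form y s\<close>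
  is then that of \<open>a * c\<close>, so \<open>\<rho>\<close> must have first component
  \<open>c\<close> to make the coefficient 1; its second component -1 is dictated by
  \<open>form s s\<close>. The second component of \<open>y\<close> may change, which
  \<open>split_third\<close> repairs.\<close>

lemma split_second:
  assumes y: "y \<in> M" "form y y = a" and d: "d \<in> R" "e * (form y x * a') * d = e"
  shows "\<exists>h\<in>H. h y = x"
proof -
  define c where "c = form y x * a'"
  have c: "c \<in> R" "e * c * d = e" "form y x = a * c"
    using scale_le[OF y(1) x_mem] d form_cancel[of y x] by (auto simp: c_def)
  have c': "form x y = a * bar c"
    using c(3) form_hermitian[of x y] by (simp add: bar_mult bar_a)
  define s where "s = e *s (y - x) + (1 - e) *s x"
  define \<rho> \<rho>' where "\<rho> = e * c - (1 - e)" and "\<rho>' = e * d - (1 - e)"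
  have s: "s \<in> M"
    using e y by (auto simp: s_def intro!: M_intros mem_intros)
  have r: "\<rho> \<in> R" "\<rho>' \<in> R"
    using c(1) d e by (auto simp: \<rho>_def \<rho>'_def intro!: mem_intros)
  have "\<rho> * \<rho>' = (e * e) * c * d - (e * (1 - e)) * (c + d) + (1 - e) * (1 - e)"
    by (simp add: \<rho>_def \<rho>'_def algebra_simps)
  then have rr: "\<rho> * \<rho>' = 1"
    using e e_bar c by simp
  have ys: "form y s = a * ((1 - e) * (1 - c) + e * c)"
    by (simp add: s_def form_simps e bar_diff y c(3) algebra_simps)
  have xs: "form x s = a * ((1 - e) * (bar c - 1) + e)"
    by (simp add: s_def form_simps e bar_diff form_x c' algebra_simps)
  have "form s s = e * (form y s - form x s) + (1 - e) * form x s"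
    by (subst s_def) (simp add: form_simps)
  also have "\<dots> = a * ((e * (1 - e)) * (3 - c - bar c) + (e * e) * (c - 1)
      + ((1 - e) * (1 - e)) * (bar c - 1))"
    unfolding xs ys by (simp add: algebra_simps)
  also have "\<dots> = a * (\<rho> + bar \<rho>)"
    unfolding e_bar e(2) by (simp add: \<rho>_def bar_simps e algebra_simps)
  finally have sym: "s \<in> M" "\<rho> \<in> R" "\<rho>' \<in> R" "\<rho> * \<rho>' = 1" "form s s = a * (\<rho> + bar \<rho>)"
    using s r rr by auto
  define y' where "y' = symmetry scale form s (a * \<rho>) y"
  have y': "y' \<in> M" "form y' y' = a"
    using admissible_step[OF admissible_unit[OF sym] y(1)] y by (auto simp: y'_def)
  have "e * (form y s * a' * \<rho>') = (a * a') * (e * ((1 - e) * (1 - c) + e * c) * \<rho>')"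
    unfolding ys by (simp add: algebra_simps)
  also have "\<dots> = (e * (1 - e)) * (1 - c) * \<rho>' + (e * e) * c * (e * d) - (e * (1 - e)) * e * c"
    by (simp add: a_inv \<rho>'_def algebra_simps)
  also have "\<dots> = (e * e) * c * d"
    by (simp add: e_bar e(2) algebra_simps)
  finally have "e * (form y s * a' * \<rho>') = e"
    using c e by simp
  then have "e *s y' = e *s y - e *s s"
    using symmetry_unit[OF sym] by (simp add: y'_def scale_right_diff_distrib)
  also have "e *s s = (e * e) *s (y - x) + (e * (1 - e)) *s x"
    by (simp add: s_def scale_right_distrib)
  also have "\<dots> = e *s y - e *s x"
    by (simp add: e e_bar scale_right_diff_distrib)
  finally have "e *s y' = e *s x"
    by simp
  from split_third[OF y' this] obtain h where "h \<in> H" "h y' = x"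
    by blast
  then have "(h \<circ> symmetry scale form s (a * \<rho>)) y = x" "h \<circ> symmetry scale form s (a * \<rho>) \<in> H"
    using H_comp H_admissible[OF admissible_unit[OF sym]] by (auto simp: y'_def)
  then show ?thesis
    by blast
qed

text \<open>The fixed element has the first component of \<open>c\<close> in both places. Passing to
  it makes the locality of the fixed elements applicable to a single component.\<close>

lemma split_unitE:
  assumes "c \<in> R" "e * c + (1 - e) * bar c \<in> units"
  obtains d where "d \<in> R" "e * c * d = e"
proof -
  obtain d where d: "d \<in> R" "(e * c + (1 - e) * bar c) * d = 1"
    using assms by (auto simp: units_def)
  have "e = e * ((e * c + (1 - e) * bar c) * d)"
    using d by simp
  also have "\<dots> = (e * e) * c * d + (e * (1 - e)) * bar c * d"
    by (simp add: algebra_simps)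
  finally show ?thesis
    using that[OF d(1)] e e_bar by simp
qed

text \<open>In the split case the first components of \<open>x\<close> and \<open>y\<close> are matched first and then the second ones;
  the former requires that the first component of \<open>c = \<langle>y, x\<rangle>/a\<close> is a unit, which can be achieved
  by a transvection.\<close>

lemma transitive_split:
  assumes y: "y \<in> M" "form y y = a"
  shows "\<exists>h\<in>H. h y = x"
proof -
  define c where "c = form y x * a'"
  have c: "c \<in> R" "form y x = a * c"
    using scale_le[OF y(1) x_mem] form_cancel[of y x] by (auto simp: c_def)
  have c': "form x y = a * bar c"
    using c(2) form_hermitian[of x y] by (simp add: bar_mult bar_a)
  have fixed: "bar (e * z + (1 - e) * bar z) = e * z + (1 - e) * bar z" for z
    by (simp add: bar_simps e)
  show ?thesis
  proof (cases "e * c + (1 - e) * bar c \<in> units")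
    case True
    then show ?thesis
      using split_unitE[OF c(1)] split_second[OF y] by (metis c_def)
  next
    case False
    \<comment> \<open>After the transvection the first component of \<open>form y' x * a'\<close>
      will be that of \<open>t - 1\<close>. It is a unit: the first component of \<open>t\<close> is
      a multiple of that of \<open>c\<close>, a non-unit.\<close>
    define t where "t = c * (1 + bar c)"
    have t: "t \<in> R"
      using c by (auto simp: t_def intro: mem_intros)
    have "e * t + (1 - e) * bar t = (e * c + (1 - e) * bar c) * (e * (1 + bar c) + (1 - e) * (1 + c))"
    proof -
      have "(e * c + (1 - e) * bar c) * (e * (1 + bar c) + (1 - e) * (1 + c))
        = (e * e) * t + ((1 - e) * (1 - e)) * bar t + (e * (1 - e)) * (c * (1 + c) + bar c * (1 + bar c))"
        by (simp add: t_def bar_simps algebra_simps)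
      then show ?thesis
        by (simp add: e e_bar)
    qed
    moreover have "e * c + (1 - e) * bar c \<in> R" "e * (1 + bar c) + (1 - e) * (1 + c) \<in> R"
      using c e by (auto intro!: mem_intros)
    ultimately have "e * t + (1 - e) * bar t \<notin> units"
      using False units_mult_left by metis
    then have "1 - (e * t + (1 - e) * bar t) \<in> units"
      using fixed_units_cases[OF fixed[of t]] t e by (auto simp: mem_intros)
    then have "- (1 - (e * t + (1 - e) * bar t)) \<in> units"
      by (simp only: units_uminus_iff)
    also have "- (1 - (e * t + (1 - e) * bar t)) = e * (t - 1) + (1 - e) * bar (t - 1)"
      by (simp add: bar_simps algebra_simps)
    finally obtain d where d: "d \<in> R" "e * (t - 1) * d = e"
      using split_unitE t by (metis diff_mem one_mem)
    \<comment> \<open>\<open>y - c *s x\<close> is orthogonal to \<open>x\<close>, which makes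
      \<open>s\<close> isotropic.\<close>
    define s where "s = e *s x + (1 - e) *s (y - c *s x)"
    have s: "s \<in> M"
      using e y c by (auto simp: s_def intro!: M_intros mem_intros)
    have ys: "form y s = a * ((1 - e) * c + e * (1 - bar c * c))"
      by (simp add: s_def form_simps e bar_diff bar_mult y c(2) algebra_simps)
    have xs: "form x s = a * (1 - e)"
      by (simp add: s_def form_simps e bar_diff bar_mult form_x c' algebra_simps)
    have "form s s = e * form x s + (1 - e) * (form y s - c * form x s)"
      by (subst s_def) (simp add: form_simps)
    also have "\<dots> = a * (e * (1 - e)) * (1 + (1 - bar c * c))"
      unfolding xs ys by (simp add: algebra_simps)
    finally have "form s s = 0"
      by (simp add: e_bar)
    moreover have "(e - (1 - e)) + bar (e - (1 - e)) = 0"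
      unfolding bar_diff bar_1 e(3) by simp
    ultimately have sym: "s \<in> M" "e - (1 - e) \<in> R" "e - (1 - e) \<in> R" "(e - (1 - e)) * (e - (1 - e)) = 1"
      "form s s = a * ((e - (1 - e)) + bar (e - (1 - e)))"
      using s split_invertible diff_mem[OF e(1) diff_mem[OF one_mem e(1)]]
      by (simp_all only: mult_zero_right)
    define y' where "y' = symmetry scale form s (a * (e - (1 - e))) y"
    have y': "y' \<in> M" "form y' y' = a"
      using admissible_step[OF admissible_unit[OF sym] y(1)] y by (auto simp: y'_def)
    have sx: "form s x = a * e + (1 - e) * (a * c - c * a)"
      by (simp add: s_def form_simps form_x c algebra_simps)
    have "e * (form y' x * a') = (a * a') * (e * c) -
      (a * a') * (a * a') * (e * e) * ((1 - e) * c + e * (1 - bar c * c)) * (e - (1 - e))"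
      using symmetry_unit[OF sym] by (simp add: y'_def form_simps ys sx c(2) algebra_simps)
    also have "\<dots> = e * c - (e * (1 - e)) * e * c * (e - (1 - e))
        - ((e * e) * (e * e) - (e * e) * (e * (1 - e))) * (1 - bar c * c)"
      unfolding a_inv by (simp add: algebra_simps)
    also have "\<dots> = e * (t - 1)"
      unfolding e_bar e(2) by (simp add: t_def algebra_simps)
    finally obtain h where "h \<in> H" "h y' = x"
      using split_second[OF y' d(1)] d(2) by auto
    then have "(h \<circ> symmetry scale form s (a * (e - (1 - e)))) y = x"
        "h \<circ> symmetry scale form s (a * (e - (1 - e))) \<in> H"
      using H_comp H_admissible[OF admissible_unit[OF sym]] by (auto simp: y'_def)
    then show ?thesis
      by blast
  qed
qed

end

lemma transitive:
  assumes "y \<in> M" "form y y = a"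
  shows "\<exists>h\<in>H. h y = x"
  using split_or_local
proof
  assume "\<exists>e\<in>R. e * e = e \<and> bar e = 1 - e"
  then show ?thesis
    using transitive_split assms by blast
next
  assume "\<exists>u\<in>R. (\<exists>u'\<in>R. u * u' = 1) \<and> u + bar u = 1 \<and>
        (\<forall>t\<in>R. (\<exists>y\<in>R. t * y = 1) \<or> (\<exists>y\<in>R. (1 - t) * y = 1))"
  then obtain u where "u \<in> units" "u + bar u = 1" "\<And>t. t \<in> R \<Longrightarrow> t \<in> units \<or> 1 - t \<in> units"
    by (auto simp: units_def diff_mem one_mem)
  then show ?thesis
    using transitive_local assms by blast
qed

end

section \<open>Orthogonal splittings and reduction to isometries fixing a basis\<close>

context hermitian_order
begin

definition norm_inverse :: "'v \<Rightarrow> 'e" where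
  "norm_inverse x = (SOME a. form x x * a = 1)"

lemma norm_inverse_eq: "form x x * a = 1 \<Longrightarrow> norm_inverse x = a"
  unfolding norm_inverse_def by (rule some_equality) (auto, metis mult.commute mult.left_commute mult_1)

definition projection :: "'v set \<Rightarrow> 'v \<Rightarrow> 'v" where
  "projection X z = (\<Sum>x\<in>X. (form z x * norm_inverse x) *s x)"

definition perp :: "'v set \<Rightarrow> 'v set \<Rightarrow> 'v set" where
  "perp X M = {z \<in> M. \<forall>x\<in>X. form z x = 0}"

definition orthogonal_family :: "'v set \<Rightarrow> bool" where
  "orthogonal_family X \<longleftrightarrow> finite X \<and> (\<forall>x\<in>X. \<forall>y\<in>X. x \<noteq> y \<longrightarrow> form x y = 0) \<and>
    (\<forall>x\<in>X. form x x * norm_inverse x = 1)"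

text \<open>Integrality of the coefficients of \<open>projection X\<close> makes \<open>M\<close>
  the orthogonal sum of the \<open>R\<close>-span of \<open>X\<close> and
  \<open>perp X M\<close>.\<close>

definition splits :: "'v set \<Rightarrow> 'v set \<Rightarrow> bool" where
  "splits X M \<longleftrightarrow> orthogonal_family X \<and> X \<subseteq> M \<and> (\<forall>z\<in>M. \<forall>x\<in>X. form z x * norm_inverse x \<in> R)"

lemma form_eq_0_sym: "form x y = 0 \<Longrightarrow> form y x = 0"
  using form_hermitian[of y x] by simp

lemma form_projection:
  assumes "orthogonal_family X" "y \<in> X"
  shows "form (projection X z) y = form z y"
proof -
  have "form (projection X z) y = (\<Sum>x\<in>X. form z x * norm_inverse x * form x y)"
    by (simp add: projection_def form_sum_left form_scale_left)
  also have "\<dots> = (\<Sum>x\<in>X. if x = y then form z y * norm_inverse y * form y y else 0)"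
    using assms by (intro sum.cong) (auto simp: orthogonal_family_def)
  also have "\<dots> = form z y * (form y y * norm_inverse y)"
    using assms by (simp add: orthogonal_family_def mult.assoc mult.commute[of "form y y"])
  finally show ?thesis
    using assms by (simp add: orthogonal_family_def)
qed

lemma form_projection_perp:
  assumes "\<And>x. x \<in> X \<Longrightarrow> form x y = 0"
  shows "form (projection X z) y = 0"
  using assms by (simp add: projection_def form_sum_left form_scale_left)

lemma perp_submodule: "submodule_over R M \<Longrightarrow> submodule_over R (perp X M)"
  by (auto simp: submodule_over_def perp_def form_simps)

lemma splits_projection:
  assumes "submodule_over R M" "0 \<in> M" "splits X M" "z \<in> M"
  shows "z - projection X z \<in> perp X M"
proof -
  have "projection X z \<in> M"
    unfolding projection_def using assms
    by (intro submodule_sum) (auto simp: splits_def intro!: submodule_scale)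
  then show ?thesis
    using assms form_projection[of X _ z]
    by (auto simp: perp_def splits_def form_simps intro: submodule_diff)
qed

text \<open>Lifts integrality conditions from the complement to \<open>M\<close>: against a vector
  of \<open>perp X M\<close>, any vector of \<open>M\<close> can be replaced by its component in the
  complement.\<close>

lemma splits_perp_form:
  assumes "submodule_over R M" "0 \<in> M" "splits X M" "z \<in> M" "s \<in> perp X M"
  shows "\<exists>z'\<in>perp X M. form z s = form z' s"
  using splits_projection[OF assms(1-4)] assms(5) form_projection_perp[of X s z] form_eq_0_sym
  by (intro bexI[of _ "z - projection X z"]) (auto simp: perp_def form_simps)

lemma splits_nondegenerate:
  assumes "submodule_over R M" "0 \<in> M" "splits X M" "nondegenerate_on form M"
  shows "nondegenerate_on form (perp X M)"
  unfolding nondegenerate_on_def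
proof (intro ballI impI)
  fix x assume x: "x \<in> perp X M" "\<forall>y\<in>perp X M. form x y = 0"
  have "form x y = 0" if y: "y \<in> M" for y
    using splits_perp_form[OF assms(1-3) y x(1)] x(2) form_eq_0_sym by metis
  then show "x = 0"
    using assms(4) x(1) by (auto simp: nondegenerate_on_def perp_def)
qed

lemma splits_insert:
  assumes M: "submodule_over R M" "0 \<in> M" "splits X M"
    and x: "x \<in> perp X M" "form x x * a' = 1" "\<And>z. z \<in> perp X M \<Longrightarrow> form z x * a' \<in> R"
  shows "splits (insert x X) M" "x \<notin> X"
proof -
  have xX: "form y x = 0 \<and> form x y = 0" if "y \<in> X" for y
    using x(1) that form_eq_0_sym by (auto simp: perp_def)
  have "form z x * a' \<in> R" if "z \<in> M" for z
    using splits_perp_form[OF M that x(1)] x(3) by metis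
  then show "splits (insert x X) M"
    using M(3) x(1,2) xX norm_inverse_eq[OF x(2)]
    by (auto simp: splits_def orthogonal_family_def perp_def)
  show "x \<notin> X"
  proof
    assume "x \<in> X"
    then have "form x x = 0"
      using xX by blast
    then show False
      using x(2) M(2) \<open>x \<in> X\<close> x(1) M(3)
      by (metis mult_zero_left scale_one scale_zero_left form_zero_left splits_def orthogonal_family_def
          zero_neq_one)
  qed
qed

text \<open>A minimal trace \<open>a\<close> of some \<open>form y z\<close> exists by nondegeneracy
  and the lower bound. It need not be a norm, but polarisation writes the norm of
  \<open>y + z\<close> as the norms of \<open>y\<close> and \<open>z\<close> plus
  \<open>a\<close>.\<close>

lemma exists_scale_vector:
  assumes sub: "submodule_over R M"
    and nondeg: "nondegenerate_on form M" and nz: "z0 \<in> M" "z0 \<noteq> 0"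
    and bound: "\<And>y z. y \<in> M \<Longrightarrow> z \<in> M \<Longrightarrow> trace bar (form y z) \<noteq> 0 \<Longrightarrow> B \<le> w (trace bar (form y z))"
  shows "\<exists>x a a'. scale_vector scale bar form R w M x a a'"
proof -
  define T where "T p = trace bar (form (fst p) (snd p))" for p
  define P where "P p \<longleftrightarrow> p \<in> M \<times> M \<and> T p \<noteq> 0" for p
  obtain y0 where y0: "y0 \<in> M" "form z0 y0 \<noteq> 0"
    using nondeg nz by (auto simp: nondegenerate_on_def)
  then obtain r where r: "r \<in> R" "r * form z0 y0 + bar (r * form z0 y0) \<noteq> 0"
    using trace_nondeg by blast
  then have "P (r *s z0, y0)"
    using submodule_scale[OF sub] nz y0 by (auto simp: P_def T_def trace_def form_scale_left)
  \<comment> \<open>Valuations are shifted by \<open>B\<close> to get a minimum over the natural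
    numbers. Truncation does no harm: the competitors all have valuation at least
    \<open>B\<close>.\<close>
  then obtain p where p: "P p" "\<And>q. P q \<Longrightarrow> nat (w (T p) - B) \<le> nat (w (T q) - B)"
    using ex_has_least_nat[of P _ "\<lambda>p. nat (w (T p) - B)"] by blast
  then obtain y z where yz: "y \<in> M" "z \<in> M" "p = (y, z)"
    by (auto simp: P_def)
  define a where "a = T p"
  have a: "bar a = a" "a \<noteq> 0"
    using p by (auto simp: a_def T_def trace_def P_def bar_simps add.commute)
  then obtain a' where a': "a * a' = 1"
    using fixed_invertible by blast
  have ba': "bar a' = a'"
    using fixed_inverse[OF a' a(1)] .
  \<comment> \<open>Minimality only says that \<open>a\<close> divides traces; self-duality extends
    this to the values of the form themselves.\<close>
  have scale_le: "form y z * a' \<in> R" if yz: "y \<in> M" "z \<in> M" for y z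
  proof (rule trace_dual)
    fix r assume r: "r \<in> R"
    define b where "b = trace bar (form (r *s y) z)"
    have "r * (form y z * a') + bar (r * (form y z * a')) = b * a'"
      by (simp add: b_def trace_def form_scale_left bar_mult ba' algebra_simps)
    also have "b * a' \<in> R"
    proof (cases "b = 0")
      case False
      then have "P (r *s y, z)"
        using yz r submodule_scale[OF sub] by (auto simp: P_def T_def b_def)
      from p(2)[OF this] have "w a \<le> w b"
        using bound[of "r *s y" z] False yz r submodule_scale[OF sub]
        by (auto simp: a_def T_def b_def)
      moreover have "bar b = b"
        by (simp add: b_def trace_def bar_simps add.commute)
      ultimately obtain c where "c \<in> R" "b = c * a"
        using fixed_dvd a False by blast
      then show ?thesis
        using a' by (simp add: mult.assoc)
    qed (simp add: zero_mem)
    finally show "r * (form y z * a') + bar (r * (form y z * a')) \<in> R" .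
  qed
  have 1: "\<exists>b b'. scale_vector scale bar form R w M x b b'"
    if x: "x \<in> M" "form x x * a' \<in> units" for x
  proof -
    obtain d where d: "d \<in> R" "form x x * a' * d = 1"
      using x(2) by (auto simp: units_def)
    then show ?thesis
      using x(1) sub mult_mem[OF scale_le d(1)] hermitian_order_axioms
      by (intro exI[of _ "form x x"] exI[of _ "a' * d"])
        (auto simp: scale_vector_def scale_vector_axioms_def mult.assoc)
  qed
  have f: "bar (form x x * a') = form x x * a'" for x
    by (simp add: bar_mult ba' form_self_fixed)
  have "form (y + z) (y + z) * a' = form y y * a' + form z z * a' + (form y z + form z y) * a'"
    by (simp add: form_simps algebra_simps)
  moreover have "(form y z + form z y) * a' = 1"
    using a' form_hermitian[of z y] by (simp add: a_def T_def yz trace_def)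
  ultimately have "form (y + z) (y + z) * a' = form y y * a' + form z z * a' + 1"
    by simp
  \<comment> \<open>If the first two are non-units, the third is their sum plus 1, hence a unit by
    locality.\<close>
  then have "form y y * a' \<in> units \<or> form z z * a' \<in> units \<or> form (y + z) (y + z) * a' \<in> units"
    using fixed_nonunits_add[of "form y y * a'" "form z z * a'"] f scale_le yz by metis
  then show ?thesis
    using 1 submodule_add[OF sub yz(1,2)] yz by blast
qed

text \<open>Each round enlarges \<open>X\<close> by a scale vector of its complement and composes
  \<open>f\<close> with an element of \<open>H\<close> that restores this vector. The bound
  \<open>N\<close> on orthogonal families ends the process. As \<open>H\<close> is a parameter, the
  lemma serves both for \<open>L\<close> and for its complement.\<close>

lemma reduce_to_fixing:
  assumes sub: "submodule_over R M" and zero: "0 \<in> M" and nondeg: "nondegenerate_on form M"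
    and bound: "\<And>y z. y \<in> M \<Longrightarrow> z \<in> M \<Longrightarrow> trace bar (form y z) \<noteq> 0 \<Longrightarrow> B \<le> w (trace bar (form y z))"
    and card_bound: "\<And>X. orthogonal_family X \<Longrightarrow> card X \<le> N"
    and H_admissible: "\<And>s \<sigma>. admissible M s \<sigma> \<Longrightarrow> symmetry scale form s \<sigma> \<in> H"
    and H_comp: "\<And>f g. f \<in> H \<Longrightarrow> g \<in> H \<Longrightarrow> f \<circ> g \<in> H"
    and H_id: "id \<in> H"
    and H_form: "\<And>h x y. h \<in> H \<Longrightarrow> form (h x) (h y) = form x y"
    and H_mem: "\<And>h x. h \<in> H \<Longrightarrow> x \<in> M \<Longrightarrow> h x \<in> M"
    and f: "\<And>x y. form (f x) (f y) = form x y" "\<And>x. x \<in> M \<Longrightarrow> f x \<in> M"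
  shows "\<exists>h\<in>H. \<exists>X. splits X M \<and> perp X M \<subseteq> {0} \<and> (\<forall>x\<in>X. h (f x) = x)"
proof -
  have "\<exists>h\<in>H. \<exists>X. splits X M \<and> perp X M \<subseteq> {0} \<and> (\<forall>x\<in>X. h (f x) = x)"
    if "splits X M" "\<And>x y. form (f x) (f y) = form x y" "\<And>x. x \<in> M \<Longrightarrow> f x \<in> M"
      "\<And>x. x \<in> X \<Longrightarrow> f x = x" for X f
    using that
  proof (induction "N - card X" arbitrary: X f rule: less_induct)
    case (less X f)
    show ?case
    proof (cases "perp X M \<subseteq> {0}")
      case True
      then show ?thesis
        using less.prems H_id by (intro bexI[of _ id] exI[of _ X]) auto
    next
      case False
      then obtain z0 where z0: "z0 \<in> perp X M" "z0 \<noteq> 0"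
        by blast
      have "\<exists>x a a'. scale_vector scale bar form R w (perp X M) x a a'"
      proof (rule exists_scale_vector)
        show "nondegenerate_on form (perp X M)"
          using splits_nondegenerate[OF sub zero less.prems(1) nondeg] .
        show "B \<le> w (trace bar (form y z))"
          if "y \<in> perp X M" "z \<in> perp X M" "trace bar (form y z) \<noteq> 0" for y z
          using bound that by (auto simp: perp_def)
      qed (use perp_submodule[OF sub] z0 in auto)
      then obtain x a a' where "scale_vector scale bar form R w (perp X M) x a a'"
        by blast
      then interpret sv: scale_vector scale bar form R w "perp X M" x a a' .
      have ins: "splits (insert x X) M" "x \<notin> X"
        using splits_insert[OF sub zero less.prems(1) sv.x_mem, of a'] sv.form_x sv.a_inv
          sv.scale_le sv.x_mem by auto
      \<comment> \<open>Vectors restored earlier must stay fixed; symmetries along vectors of the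
        complement respect this.\<close>
      define H' where "H' = {h \<in> H. \<forall>x\<in>X. h x = x}"
      interpret sc: symmetry_closed scale bar form R w "perp X M" x a a' H'
      proof
        fix s \<sigma> assume adm: "admissible (perp X M) s \<sigma>"
        then obtain \<tau> where t: "s \<in> perp X M" "form s s = trace bar \<sigma>" "\<sigma> * \<tau> = 1"
          "\<And>z. z \<in> perp X M \<Longrightarrow> form z s * \<tau> \<in> R \<and> form z s * bar \<tau> \<in> R"
          by (auto simp: admissible_def)
        have "form z s * \<tau> \<in> R \<and> form z s * bar \<tau> \<in> R" if "z \<in> M" for z
          using splits_perp_form[OF sub zero less.prems(1) that t(1)] t(4) by metis
        then have "admissible M s \<sigma>"
          using t by (auto simp: admissible_def perp_def)
        moreover have "symmetry scale form s \<sigma> x = x" if "x \<in> X" for x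
          using t(1) that form_eq_0_sym by (simp add: symmetry_eq[OF t(3)] perp_def)
        ultimately show "symmetry scale form s \<sigma> \<in> H'"
          using H_admissible by (auto simp: H'_def)
      next
        fix f g assume "f \<in> H'" "g \<in> H'"
        then show "f \<circ> g \<in> H'"
          using H_comp by (auto simp: H'_def)
      qed
      \<comment> \<open>\<open>f\<close> preserves the form and fixes \<open>X\<close>, so it keeps
        \<open>x\<close> in the complement, where transitivity applies.\<close>
      have "form (f x) y = 0" if "y \<in> X" for y
        using less.prems(2)[of x y] less.prems(4)[OF that] sv.x_mem that by (simp add: perp_def)
      then have "f x \<in> perp X M"
        using sv.x_mem less.prems(3) by (auto simp: perp_def)
      moreover have "form (f x) (f x) = a"
        using less.prems(2) sv.form_x by simp
      ultimately obtain h where h: "h \<in> H" "\<And>y. y \<in> X \<Longrightarrow> h y = y" "h (f x) = x"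
        using sc.transitive by (force simp: H'_def)
      have "card (insert x X) \<le> N"
        using card_bound ins(1) by (auto simp: splits_def)
      then have lt: "N - card (insert x X) < N - card X"
        using ins less.prems(1) by (auto simp: splits_def orthogonal_family_def)
      have hf: "(h \<circ> f) y = y" if "y \<in> insert x X" for y
        using that h less.prems(4) by auto
      obtain g Y where g: "g \<in> H" "splits Y M" "perp Y M \<subseteq> {0}" "\<forall>y\<in>Y. g ((h \<circ> f) y) = y"
        using less.hyps[OF lt ins(1), of "h \<circ> f"] hf less.prems h H_form H_mem by (auto 0 0)
      then show ?thesis
        using H_comp[OF g(1) h(1)] by (intro bexI[of _ "g \<circ> h"] exI[of _ Y]) auto
    qed
  qed
  from this[of "{}" f] f show ?thesis
    by (auto simp: splits_def orthogonal_family_def)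
qed

lemma projection_id:
  assumes "submodule_over R M" "0 \<in> M" "splits X M" "perp X M \<subseteq> {0}" "z \<in> M"
  shows "projection X z = z"
  using splits_projection[OF assms(1-3,5)] assms(4) by auto

lemma linear_fixes_projection:
  assumes "module_hom scale scale h" "\<And>x. x \<in> X \<Longrightarrow> h x = x"
  shows "h (projection X z) = projection X z"
proof -
  interpret h: module_hom scale scale h by fact
  show ?thesis
    using assms(2) by (simp add: projection_def h.sum h.scale)
qed

end

section \<open>Valuation rings and integrality\<close>

context nonarch_local_field
begin

abbreviation "\<oo> \<equiv> valuation_ring v"
abbreviation "\<pp> \<equiv> valuation_ideal v"

lemma val_1 [simp]: "v 1 = 0"
  using val_mult[of 1 1] by simp

lemma val_uminus: "v (- x) = v x"
proof (cases "x = 0")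
  case False
  have "v (- 1) + v (- 1) = v ((- 1) * (- 1))"
    by (intro val_mult[symmetric]) auto
  then have "v (- 1) = 0"
    by simp
  then show ?thesis
    using val_mult[of "- 1" x] False by simp
qed simp

lemma val_inverse: "x \<noteq> 0 \<Longrightarrow> v (inverse x) = - v x"
  using val_mult[of x "inverse x"] by simp

lemma val_power: "x \<noteq> 0 \<Longrightarrow> v (x ^ n) = int n * v x"
  by (induction n) (auto simp: val_mult algebra_simps)

lemma valuation_ge_add: "x \<in> valuation_ge v n \<Longrightarrow> y \<in> valuation_ge v n \<Longrightarrow> x + y \<in> valuation_ge v n"
  using val_add[of x y] unfolding valuation_ge_def by fastforce

lemma valuation_ge_uminus: "x \<in> valuation_ge v n \<Longrightarrow> - x \<in> valuation_ge v n"
  by (auto simp: valuation_ge_def val_uminus)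

lemma valuation_ge_mult:
  "x \<in> valuation_ge v m \<Longrightarrow> y \<in> valuation_ge v n \<Longrightarrow> x * y \<in> valuation_ge v (m + n)"
  by (cases "x = 0 \<or> y = 0") (auto simp: valuation_ge_def val_mult)

lemma ring_0: "0 \<in> \<oo>" and ring_1: "1 \<in> \<oo>"
  by (auto simp: valuation_ring_def valuation_ge_def)

lemma ring_add: "x \<in> \<oo> \<Longrightarrow> y \<in> \<oo> \<Longrightarrow> x + y \<in> \<oo>"
  unfolding valuation_ring_def by (rule valuation_ge_add)

lemma ring_uminus: "x \<in> \<oo> \<Longrightarrow> - x \<in> \<oo>"
  unfolding valuation_ring_def by (rule valuation_ge_uminus)

lemma ring_diff: "x \<in> \<oo> \<Longrightarrow> y \<in> \<oo> \<Longrightarrow> x - y \<in> \<oo>"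
  using ring_add[OF _ ring_uminus, of x y] by simp

lemma ring_mult: "x \<in> \<oo> \<Longrightarrow> y \<in> \<oo> \<Longrightarrow> x * y \<in> \<oo>"
  using valuation_ge_mult[of x 0 y 0] by (simp add: valuation_ring_def)

lemma ideal_subset: "x \<in> \<pp> \<Longrightarrow> x \<in> \<oo>"
  by (auto simp: valuation_ring_def valuation_ideal_def valuation_ge_def)

lemma ideal_0: "0 \<in> \<pp>" and one_notin_ideal: "1 \<notin> \<pp>"
  by (auto simp: valuation_ideal_def valuation_ge_def)

lemma ideal_add: "x \<in> \<pp> \<Longrightarrow> y \<in> \<pp> \<Longrightarrow> x + y \<in> \<pp>"
  unfolding valuation_ideal_def by (rule valuation_ge_add)

lemma ideal_uminus: "x \<in> \<pp> \<Longrightarrow> - x \<in> \<pp>"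
  unfolding valuation_ideal_def by (rule valuation_ge_uminus)

lemma ideal_diff: "x \<in> \<pp> \<Longrightarrow> y \<in> \<pp> \<Longrightarrow> x - y \<in> \<pp>"
  using ideal_add[OF _ ideal_uminus, of x y] by simp

lemma ideal_mult: "x \<in> \<oo> \<Longrightarrow> y \<in> \<pp> \<Longrightarrow> x * y \<in> \<pp>"
  using valuation_ge_mult[of x 0 y 1] by (simp add: valuation_ring_def valuation_ideal_def)

lemma ideal_sum: "(\<And>i. i \<in> I \<Longrightarrow> g i \<in> \<pp>) \<Longrightarrow> sum g I \<in> \<pp>"
  by (induction I rule: infinite_finite_induct) (auto simp: ideal_0 intro: ideal_add)

lemma nonideal_mult: "x \<in> \<oo> \<Longrightarrow> y \<in> \<oo> \<Longrightarrow> x \<notin> \<pp> \<Longrightarrow> y \<notin> \<pp> \<Longrightarrow> x * y \<notin> \<pp>"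
  by (auto simp: valuation_ring_def valuation_ideal_def valuation_ge_def val_mult)

lemma inverse_mem: "x \<in> \<oo> \<Longrightarrow> x \<notin> \<pp> \<Longrightarrow> inverse x \<in> \<oo>"
  by (auto simp: valuation_ring_def valuation_ideal_def valuation_ge_def val_inverse)

lemma last_nonideal_coeff:
  assumes "coeff f i \<notin> \<pp>"
  obtains j where "coeff f j \<notin> \<pp>" "\<And>k. k > j \<Longrightarrow> coeff f k \<in> \<pp>"
proof -
  define A where "A = {i. coeff f i \<notin> \<pp>}"
  have "A \<subseteq> {..degree f}"
    using ideal_0 by (auto simp: A_def intro: le_degree)
  then have "finite A"
    by (rule finite_subset) simp
  then show ?thesis
    using assms Max_in[of A] Max_ge[of A] that[of "Max A"] by (fastforce simp: A_def)
qed

text \<open>Gauss's lemma. If \<open>i\<close> and \<open>j\<close> are the last indices with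
  coefficients outside \<open>\<pp>\<close>, every term of the coefficient at \<open>i + j\<close>
  except one has a factor in \<open>\<pp>\<close>.\<close>

lemma primitive_mult:
  assumes f: "\<And>i. coeff f i \<in> \<oo>" "coeff f i \<notin> \<pp>"
    and g: "\<And>i. coeff g i \<in> \<oo>" "coeff g j \<notin> \<pp>"
  shows "\<exists>k. coeff (f * g) k \<notin> \<pp>"
proof -
  obtain i where i: "coeff f i \<notin> \<pp>" "\<And>k. k > i \<Longrightarrow> coeff f k \<in> \<pp>"
    using last_nonideal_coeff[OF f(2)] by blast
  obtain j where j: "coeff g j \<notin> \<pp>" "\<And>k. k > j \<Longrightarrow> coeff g k \<in> \<pp>"
    using last_nonideal_coeff[OF g(2)] by blast
  have "coeff (f * g) (i + j) = coeff f i * coeff g j +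
      (\<Sum>k\<in>{..i + j} - {i}. coeff f k * coeff g (i + j - k))"
    by (simp add: coeff_mult sum.remove[of _ i])
  moreover have "(\<Sum>k\<in>{..i + j} - {i}. coeff f k * coeff g (i + j - k)) \<in> \<pp>"
  proof (rule ideal_sum)
    fix k assume "k \<in> {..i + j} - {i}"
    then consider "k > i" | "i + j - k > j"
      by force
    then show "coeff f k * coeff g (i + j - k) \<in> \<pp>"
    proof cases
      case 1
      then show ?thesis
        using ideal_mult[OF g(1) i(2)] by (simp add: mult.commute)
    qed (rule ideal_mult[OF f(1) j(2)])
  qed
  ultimately show ?thesis
    using nonideal_mult[OF f(1) g(1) i(1) j(1)] ideal_diff by (metis add_diff_cancel_right')
qed

text \<open>Divide by a coefficient of least valuation. The leading coefficient has valuation 0, so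
  this least value is at most 0, and it is negative if \<open>f\<close> is not integral.\<close>

lemma monic_primitive_multiple:
  assumes "lead_coeff f = 1"
  obtains c i where "c \<in> \<oo>" "c \<noteq> 0" "\<And>i. coeff (smult c f) i \<in> \<oo>" "coeff (smult c f) i \<notin> \<pp>"
    "(\<exists>i. coeff f i \<notin> \<oo>) \<Longrightarrow> c \<in> \<pp>"
proof -
  define A where "A = {i. coeff f i \<noteq> 0}"
  have "A \<subseteq> {..degree f}"
    by (auto simp: A_def intro: le_degree)
  then have fin: "finite A"
    by (rule finite_subset) simp
  have d: "degree f \<in> A"
    using assms by (simp add: A_def)
  define i where "i = arg_min_on (\<lambda>i. v (coeff f i)) A"
  have i: "i \<in> A" "\<And>j. j \<in> A \<Longrightarrow> v (coeff f i) \<le> v (coeff f j)"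
    using arg_min_if_finite[OF fin, of "\<lambda>i. v (coeff f i)"] d fin
    by (auto simp: i_def not_less)
  define c where "c = inverse (coeff f i)"
  have c: "c \<noteq> 0" "v c = - v (coeff f i)"
    using i by (auto simp: c_def A_def val_inverse)
  have vc: "v (coeff f i) \<le> 0"
    using i(2)[OF d] assms by simp
  show ?thesis
  proof
    show "c \<in> \<oo>" "c \<noteq> 0"
      using c vc by (auto simp: valuation_ring_def valuation_ge_def)
    show "coeff (smult c f) j \<in> \<oo>" for j
      using i(2)[of j] c
      by (cases "coeff f j = 0") (auto simp: A_def valuation_ring_def valuation_ge_def val_mult)
    show "coeff (smult c f) i \<notin> \<pp>"
      using i(1) one_notin_ideal by (simp add: c_def A_def)
    show "c \<in> \<pp>" if "\<exists>i. coeff f i \<notin> \<oo>"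
      using that c i(2) by (force simp: A_def valuation_ring_def valuation_ideal_def valuation_ge_def)
  qed
qed

text \<open>If \<open>q\<close> were not integral, its primitive multiple would have a factor
  \<open>c\<close> in \<open>\<pp>\<close>. The product with a primitive multiple of
  \<open>h\<close> is then \<open>c\<close> times an integral polynomial, against Gauss's
  lemma.\<close>

lemma monic_factor_integral:
  assumes p: "p = q * h" "lead_coeff p = 1" "lead_coeff q = 1" "\<And>i. coeff p i \<in> \<oo>"
  shows "coeff q i \<in> \<oo>"
proof (rule ccontr)
  assume q: "coeff q i \<notin> \<oo>"
  have h: "lead_coeff h = 1"
    using p by (simp add: lead_coeff_mult)
  obtain c k where c: "c \<in> \<oo>" "\<And>i. coeff (smult c q) i \<in> \<oo>" "coeff (smult c q) k \<notin> \<pp>" "c \<in> \<pp>"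
    using monic_primitive_multiple[OF p(3)] q by metis
  obtain d l where d: "d \<in> \<oo>" "\<And>i. coeff (smult d h) i \<in> \<oo>" "coeff (smult d h) l \<notin> \<pp>"
    using monic_primitive_multiple[OF h] by metis
  obtain m where m: "coeff (smult c q * smult d h) m \<notin> \<pp>"
    using primitive_mult[OF c(2,3) d(2,3)] by blast
  have "coeff (smult c q * smult d h) m = (coeff (q * h) m * d) * c"
    by (simp add: ac_simps)
  then show False
    using m ideal_mult[OF ring_mult[OF p(4) d(1)] c(4)] p(1) by metis
qed

end

section \<open>Quadratic algebras with a generator\<close>

context quadratic_algebra
begin

lemma emb_0 [simp]: "\<iota> 0 = 0"
  using emb_add[of 0 0] by simp

lemma emb_uminus: "\<iota> (- a) = - \<iota> a"
  using emb_add[of a "- a"] by (simp add: eq_neg_iff_add_eq_0 add.commute)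

lemma emb_diff: "\<iota> (a - b) = \<iota> a - \<iota> b"
  using emb_add[of a "- b"] by (simp add: emb_uminus)

lemma emb_sum: "\<iota> (sum g I) = (\<Sum>i\<in>I. \<iota> (g i))"
  by (induction I rule: infinite_finite_induct) (auto simp: emb_add)

lemma one_neq_0: "(1 :: 'e) \<noteq> 0"
proof
  assume "(1 :: 'e) = 0"
  then have "x = y" for x y :: 'e
    by (metis mult_1 mult_zero_left)
  then show False
    using bar_nontrivial by (metis ext)
qed

lemma emb_inverse: "a \<noteq> 0 \<Longrightarrow> \<iota> a * \<iota> (inverse a) = 1"
  by (simp add: emb_one flip: emb_mult)

lemma emb_eq_0_iff [simp]: "\<iota> a = 0 \<longleftrightarrow> a = 0"
  using emb_inverse[of a] one_neq_0 by (cases "a = 0") auto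

lemma emb_eq_iff [simp]: "\<iota> a = \<iota> b \<longleftrightarrow> a = b"
  using emb_eq_0_iff[of "a - b"] by (simp add: emb_diff)

lemma vector_space_emb: "vector_space (\<lambda>a x. \<iota> a * x)"
  by unfold_locales (auto simp: algebra_simps emb_add emb_mult emb_one)

lemma emb_cancel:
  assumes "a \<noteq> 0" "\<iota> a * x = \<iota> a * y"
  shows "x = y"
proof -
  have "\<iota> a * \<iota> (inverse a) * x = \<iota> a * \<iota> (inverse a) * y"
    using assms(2) by (simp add: mult.assoc mult.left_commute[of "\<iota> a"])
  then show ?thesis
    using emb_inverse[OF assms(1)] by simp
qed

lemma bar_0' [simp]: "bar 0 = 0"
  using bar_add[of 0 0] by simp

lemma bar_1' [simp]: "bar 1 = 1"
  using bar_emb[of 1] by (simp add: emb_one)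

lemma bar_uminus': "bar (- x) = - bar x"
  using bar_add[of x "- x"] by (simp add: eq_neg_iff_add_eq_0 add.commute)

lemma bar_diff': "bar (x - y) = bar x - bar y"
  using bar_add[of x "- y"] by (simp add: bar_uminus')

lemma bar_generator_neq:
  assumes "\<And>x. \<exists>a b. x = \<iota> a + \<iota> b * \<theta>"
  shows "bar \<theta> \<noteq> \<theta>"
proof
  assume "bar \<theta> = \<theta>"
  then have "bar x = x" for x
    using assms[of x] by (auto simp: bar_add bar_mult bar_emb)
  then show False
    using bar_nontrivial by auto
qed

lemma exists_generator: "\<exists>\<theta>. \<forall>x. \<exists>a b. x = \<iota> a + \<iota> b * \<theta>"
proof -
  interpret E: vector_space "\<lambda>a x. \<iota> a * x"
    by (rule vector_space_emb)
  have "E.independent {1}"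
    using one_neq_0 by simp
  then obtain B where B: "{1} \<subseteq> B" "E.independent B" "UNIV \<subseteq> E.span B"
    using E.maximal_independent_subset_extend[of "{1}" UNIV] by (metis subset_UNIV)
  then have "card B = 2"
    using E.dim_eq_card[of B UNIV] dim_2 by auto
  then obtain \<theta> where "B = {1, \<theta>}"
    using B(1) by (auto simp: card_2_iff doubleton_eq_iff)
  then have "\<exists>a b. x = \<iota> a + \<iota> b * \<theta>" for x
    using B(3) E.span_breakdown_eq[of x 1 "{\<theta>}"] E.span_singleton[of \<theta>]
    by (auto simp: image_iff algebra_simps)
  then show ?thesis
    by blast
qed

end

text \<open>Common ground of the split and the field case. \<open>disc_invertible\<close> expresses
  that the algebra is etale; it yields that the fixed elements are those of \<open>K\<close> and
  that the trace form is nondegenerate.\<close>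

locale quadratic_generator = quadratic_algebra \<iota> bar
  for \<iota> :: "'k::field \<Rightarrow> 'e::comm_ring_1" and bar +
  fixes \<theta> t n
  assumes generator: "\<exists>a b. x = \<iota> a + \<iota> b * \<theta>"
    and trace_generator: "\<theta> + bar \<theta> = \<iota> t"
    and norm_generator: "\<theta> * bar \<theta> = \<iota> n"
    and disc_invertible: "\<exists>\<delta>. (\<theta> - bar \<theta>) * \<delta> = 1"
begin

lemma bar_generator: "bar \<theta> = \<iota> t - \<theta>"
  using trace_generator by (simp add: algebra_simps)

lemma bar_bar': "bar (bar x) = x"
  using generator[of x] by (auto simp: bar_add bar_mult bar_emb bar_generator bar_diff')

lemma fixed_emb:
  assumes "bar x = x"
  obtains a where "x = \<iota> a"
proof -
  obtain a b where x: "x = \<iota> a + \<iota> b * \<theta>"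
    using generator by blast
  then have "\<iota> b * (\<theta> - bar \<theta>) = 0"
    using assms by (simp add: bar_add bar_mult bar_emb algebra_simps)
  then have "\<iota> b = 0"
    using disc_invertible by (metis mult.assoc mult.right_neutral mult_zero_left)
  then show ?thesis
    using that x by simp
qed

lemma trace_emb: obtains a where "x + bar x = \<iota> a"
  by (rule fixed_emb[of "x + bar x"]) (simp_all add: bar_add bar_bar' add.commute)

lemma norm_emb: obtains a where "x * bar x = \<iota> a"
  by (rule fixed_emb[of "x * bar x"]) (simp_all add: bar_mult bar_bar' mult.commute)

lemma trace_form_nondeg:
  assumes "x + bar x = 0" "\<theta> * x + bar (\<theta> * x) = 0"
  shows "x = 0"
proof -
  have "bar x = - x"
    using assms(1) by (simp add: eq_neg_iff_add_eq_0 add.commute)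
  then have "x * (\<theta> - bar \<theta>) = 0"
    using assms(2) by (simp add: bar_mult algebra_simps)
  then show ?thesis
    using disc_invertible by (metis mult.assoc mult.right_neutral mult_zero_left)
qed

end

locale local_quadratic_generator = nonarch_local_field v + quadratic_generator \<iota> bar \<theta> t n
  for v :: "'k::field \<Rightarrow> int" and \<iota> :: "'k \<Rightarrow> 'e::comm_ring_1" and bar \<theta> t n
begin

abbreviation "\<O> \<equiv> integral_closure v \<iota>"

lemma eval_mult: "poly (map_poly \<iota> (p * q)) x = poly (map_poly \<iota> p) x * poly (map_poly \<iota> q) x"
proof -
  have "map_poly \<iota> (p * q) = map_poly \<iota> p * map_poly \<iota> q"
    by (rule poly_eqI) (simp add: coeff_map_poly coeff_mult emb_sum emb_mult)
  then show ?thesis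
    by simp
qed

lemma eval_add: "poly (map_poly \<iota> (p + q)) x = poly (map_poly \<iota> p) x + poly (map_poly \<iota> q) x"
proof -
  have "map_poly \<iota> (p + q) = map_poly \<iota> p + map_poly \<iota> q"
    by (rule poly_eqI) (simp add: coeff_map_poly emb_add)
  then show ?thesis
    by simp
qed

lemma eval_emb: "poly (map_poly \<iota> p) (\<iota> a) = \<iota> (poly p a)"
  by (induction p) (auto simp: map_poly_pCons emb_add emb_mult)

text \<open>For \<open>x\<close> outside \<open>K\<close> the polynomial \<open>q\<close> with the
  trace and norm of \<open>x\<close> as coefficients divides every polynomial over \<open>K\<close>
  that kills \<open>x\<close>, also when the algebra is not a field; so it inherits integrality from
  a monic integral multiple. For \<open>x\<close> in \<open>K\<close> the linear polynomial plays
  this role.\<close>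

lemma integral_iff:
  "x \<in> \<O> \<longleftrightarrow> (\<exists>a\<in>\<oo>. \<exists>b\<in>\<oo>. x + bar x = \<iota> a \<and> x * bar x = \<iota> b)"
proof
  assume "x \<in> \<O>"
  then obtain p where p: "lead_coeff p = 1" "\<And>i. coeff p i \<in> \<oo>" "poly (map_poly \<iota> p) x = 0"
    by (auto simp: integral_closure_def)
  show "\<exists>a\<in>\<oo>. \<exists>b\<in>\<oo>. x + bar x = \<iota> a \<and> x * bar x = \<iota> b"
  proof (cases "x \<in> range \<iota>")
    case True
    then obtain a where a: "x = \<iota> a"
      by blast
    then have "[:- a, 1:] dvd p"
      using p(3) by (simp add: eval_emb poly_eq_0_iff_dvd)
    then obtain h where "p = [:- a, 1:] * h"
      by (auto elim: dvdE)
    from monic_factor_integral[OF this p(1) _ p(2), of 0] have "- a \<in> \<oo>"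
      by simp
    then have "a \<in> \<oo>"
      using ring_uminus by fastforce
    then show ?thesis
      using a ring_add[of a a] ring_mult[of a a] by (metis bar_emb emb_add emb_mult)
  next
    case False
    obtain a b where ab: "x + bar x = \<iota> a" "x * bar x = \<iota> b"
      using trace_emb[of x] norm_emb[of x] by metis
    define q where "q = [:b, - a, 1:]"
    have "poly (map_poly \<iota> q) x = x * bar x - (x + bar x) * x + x * x"
      by (simp add: q_def map_poly_pCons emb_one emb_uminus ab algebra_simps)
    then have q: "poly (map_poly \<iota> q) x = 0"
      by (simp add: algebra_simps)
    have "poly (map_poly \<iota> p) x = poly (map_poly \<iota> (q * (p div q) + p mod q)) x"
      by simp
    then have r: "poly (map_poly \<iota> (p mod q)) x = 0"
      using p(3) q by (simp only: eval_add eval_mult) simp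
    have "degree (p mod q) < 2 \<or> p mod q = 0"
      using degree_mod_less[of q p] by (auto simp: q_def)
    then have "degree (p mod q) \<le> 1"
      by auto
    then have rc: "p mod q = [:coeff (p mod q) 0, coeff (p mod q) 1:]"
      by (intro poly_eqI) (auto simp: coeff_pCons coeff_eq_0 split: nat.splits)
    define c d where "c = coeff (p mod q) 0" and "d = coeff (p mod q) 1"
    have cd: "p mod q = [:c, d:]"
      using rc by (simp add: c_def d_def)
    have "\<iota> c + \<iota> d * x = 0"
      using r by (simp add: cd map_poly_pCons algebra_simps)
    \<comment> \<open>A nonzero \<open>d\<close> would be invertible and put \<open>x\<close> into
      \<open>K\<close>.\<close>
    moreover have "d = 0"
    proof (rule ccontr)
      assume "d \<noteq> 0"
      then have "x = \<iota> d * \<iota> (inverse d) * x"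
        using emb_inverse by simp
      also have "\<dots> = \<iota> (inverse d) * (\<iota> c + \<iota> d * x) + \<iota> (- c * inverse d)"
        by (simp add: emb_mult emb_uminus algebra_simps)
      finally show False
        using \<open>\<iota> c + \<iota> d * x = 0\<close> False by auto
    qed
    ultimately have "p mod q = 0"
      using cd by simp
    then have "p = q * (p div q)"
      by (metis add.right_neutral mult_div_mod_eq)
    from monic_factor_integral[OF this p(1) _ p(2)] have i: "coeff q i \<in> \<oo>" for i
      by (simp add: q_def)
    have "b \<in> \<oo>" "- a \<in> \<oo>"
      using i[of 0] i[of 1] by (simp_all add: q_def)
    then show ?thesis
      using ab ring_uminus by fastforce
  qed
next
  assume "\<exists>a\<in>\<oo>. \<exists>b\<in>\<oo>. x + bar x = \<iota> a \<and> x * bar x = \<iota> b"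
  then obtain a b where ab: "a \<in> \<oo>" "b \<in> \<oo>" "x + bar x = \<iota> a" "x * bar x = \<iota> b"
    by blast
  have "poly (map_poly \<iota> [:b, - a, 1:]) x = x * bar x - (x + bar x) * x + x * x"
    by (simp add: map_poly_pCons emb_one emb_uminus ab(3,4) algebra_simps)
  moreover have "coeff [:b, - a, 1:] i \<in> \<oo>" for i
    using ab ring_uminus ring_0 ring_1 by (auto simp: coeff_pCons split: nat.splits)
  ultimately show "x \<in> \<O>"
    unfolding integral_closure_def
    by (intro CollectI exI[of _ "[:b, - a, 1:]"]) (auto simp: algebra_simps)
qed

end

section \<open>The conjugation orders: whole algebra and integral closure\<close>

context quadratic_generator
begin

text \<open>Here the characteristic enters: in the field case 1/2 is the unit of trace 1.\<close>

lemma conjugation_order_whole_algebra: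
  assumes "(\<exists>e. e * e = e \<and> bar e = 1 - e) \<or> (\<forall>x::'e. x \<noteq> 0 \<longrightarrow> (\<exists>y. x * y = 1))"
    and two: "(2 :: 'k) \<noteq> 0"
  shows "conjugation_order bar UNIV (\<lambda>_. 0)"
proof
  have inv: "\<exists>y. x * y = 1" if "bar x = x" "x \<noteq> 0" for x
    using fixed_emb[OF that(1)] emb_inverse that(2) by (metis emb_0)
  show "bar x = x \<Longrightarrow> x \<noteq> 0 \<Longrightarrow> \<exists>y. x * y = 1" for x
    using inv by blast
  show "\<exists>c\<in>UNIV. y = c * x" if "bar x = x" "x \<noteq> 0" for x y
    using inv[OF that] by (metis UNIV_I mult.commute mult.left_commute mult_1)
  show "(\<exists>y\<in>UNIV. x * y = 1) \<or> (\<exists>y\<in>UNIV. (1 - x) * y = 1)" if "bar x = x" for x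
    using inv[OF that] by (cases "x = 0") auto
  show "x = 0" if "\<And>a. a \<in> UNIV \<Longrightarrow> a * x + bar (a * x) = 0" for x
    using trace_form_nondeg[of x] that[of 1] that[of \<theta>] by simp
  show "(\<exists>e\<in>UNIV. e * e = e \<and> bar e = 1 - e) \<or> (\<exists>u\<in>UNIV. (\<exists>u'\<in>UNIV. u * u' = 1) \<and> u + bar u = 1 \<and>
      (\<forall>t\<in>UNIV :: 'e set. (\<exists>y\<in>UNIV. t * y = 1) \<or> (\<exists>y\<in>UNIV. (1 - t) * y = 1)))"
    using assms(1)
  proof
    assume fld: "\<forall>x::'e. x \<noteq> 0 \<longrightarrow> (\<exists>y. x * y = 1)"
    have "inverse 2 + inverse 2 = (1 :: 'k)"
      using two by (simp flip: mult_2)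
    then have tr: "\<iota> (inverse 2) + bar (\<iota> (inverse 2)) = 1"
      by (simp add: bar_emb emb_one flip: emb_add)
    have loc: "\<forall>t\<in>UNIV :: 'e set. (\<exists>y\<in>UNIV. t * y = 1) \<or> (\<exists>y\<in>UNIV. (1 - t) * y = 1)"
    proof
      fix t :: 'e
      show "(\<exists>y\<in>UNIV. t * y = 1) \<or> (\<exists>y\<in>UNIV. (1 - t) * y = 1)"
        using fld by (cases "t = 0") auto
    qed
    have unit: "\<exists>u'\<in>UNIV. \<iota> (inverse 2) * u' = 1"
      using emb_inverse[OF two] by (intro bexI[of _ "\<iota> 2"]) (simp_all only: mult.commute UNIV_I)
    show ?thesis
      using unit tr loc by blast
  qed blast
qed (simp_all add: bar_add bar_mult bar_bar')

end

context local_quadratic_generator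
begin

lemma emb_integral_iff: "\<iota> a \<in> \<O> \<longleftrightarrow> a \<in> \<oo>"
proof
  assume "a \<in> \<oo>"
  then show "\<iota> a \<in> \<O>"
    unfolding integral_iff bar_emb
    by (metis emb_add emb_mult ring_add ring_mult)
next
  assume "\<iota> a \<in> \<O>"
  then have "a * a \<in> \<oo>"
    by (auto simp: integral_iff bar_emb simp flip: emb_mult)
  then show "a \<in> \<oo>"
    by (cases "a = 0") (auto simp: valuation_ring_def valuation_ge_def val_mult)
qed

lemma bar_integral: "x \<in> \<O> \<Longrightarrow> bar x \<in> \<O>"
  by (simp add: integral_iff bar_bar' add.commute mult.commute)

lemma uminus_integral: "x \<in> \<O> \<Longrightarrow> - x \<in> \<O>"
  unfolding integral_iff bar_uminus'
  by (metis (no_types, lifting) emb_uminus minus_add_distrib minus_mult_minus ring_uminus)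

lemma trace_integral:
  assumes "x \<in> \<O>"
  obtains a where "a \<in> \<oo>" "x + bar x = \<iota> a"
  using assms by (auto simp: integral_iff)

lemma uniformizer_exists: obtains \<pi> where "\<pi> \<noteq> 0" "v \<pi> = 1"
  using val_normalised by blast

lemma ideal_uniformizer:
  assumes "\<pi> \<noteq> 0" "v \<pi> = 1" "a \<in> \<pp>"
  obtains b where "b \<in> \<oo>" "a = \<pi> * b"
proof (rule that)
  show "a / \<pi> \<in> \<oo>"
    using assms by (cases "a = 0")
      (auto simp: valuation_ideal_def valuation_ring_def valuation_ge_def divide_inverse val_mult val_inverse)
qed (use assms in simp)

text \<open>Trace and norm are multiplied by \<open>\<pi> ^ k\<close> and its square. Having all
  large \<open>k\<close> allows a common denominator for finitely many elements.\<close>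

lemma scale_integral:
  assumes pi: "\<pi> \<noteq> 0" "v \<pi> = 1"
  shows "\<exists>m. \<forall>k\<ge>m. \<iota> (\<pi> ^ k) * x \<in> \<O>"
proof -
  obtain a b where ab: "x + bar x = \<iota> a" "x * bar x = \<iota> b"
    using trace_emb[of x] norm_emb[of x] by metis
  define m where "m = nat (max (- v a) (- v b))"
  have "\<iota> (\<pi> ^ k) * x \<in> \<O>" if "k \<ge> m" for k
  proof -
    have "\<pi> ^ k * a \<in> \<oo>"
      using that pi by (cases "a = 0")
        (auto simp: valuation_ring_def valuation_ge_def val_mult val_power m_def)
    moreover have "\<pi> ^ k * \<pi> ^ k * b \<in> \<oo>"
      using that pi by (cases "b = 0")
        (auto simp: valuation_ring_def valuation_ge_def val_mult val_power m_def)
    moreover have "\<iota> (\<pi> ^ k) * x + bar (\<iota> (\<pi> ^ k) * x) = \<iota> (\<pi> ^ k * a)"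
      by (simp add: bar_mult bar_emb emb_mult flip: ab distrib_left)
    moreover have "\<iota> (\<pi> ^ k) * x * bar (\<iota> (\<pi> ^ k) * x) = \<iota> (\<pi> ^ k * \<pi> ^ k * b)"
      by (simp add: bar_mult bar_emb emb_mult ac_simps flip: ab)
    ultimately show ?thesis
      unfolding integral_iff by blast
  qed
  then show ?thesis
    by blast
qed

text \<open>The valuation of \<open>K\<close> carried over to the fixed elements, where the preimage
  is unique; elsewhere the value is arbitrary.\<close>

definition fixed_val :: "'e \<Rightarrow> int" where
  "fixed_val x = v (SOME a. x = \<iota> a)"

lemma fixed_val_emb [simp]: "fixed_val (\<iota> a) = v a"
  unfolding fixed_val_def by (rule arg_cong[of _ _ v]) (rule some_equality, auto)

text \<open>The fixed elements of \<open>\<O>\<close> are a copy of the valuation ring, which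
  settles all axioms about them. The hypotheses are what the split and the unramified case prove
  separately.\<close>

lemma conjugation_order_integral:
  assumes add: "\<And>x y. x \<in> \<O> \<Longrightarrow> y \<in> \<O> \<Longrightarrow> x + y \<in> \<O>"
    and mult: "\<And>x y. x \<in> \<O> \<Longrightarrow> y \<in> \<O> \<Longrightarrow> x * y \<in> \<O>"
    and dual: "\<And>x. (\<And>a. a \<in> \<O> \<Longrightarrow> a * x + bar (a * x) \<in> \<O>) \<Longrightarrow> x \<in> \<O>"
    and split_or_local: "(\<exists>e\<in>\<O>. e * e = e \<and> bar e = 1 - e) \<or>
      (\<exists>u\<in>\<O>. (\<exists>u'\<in>\<O>. u * u' = 1) \<and> u + bar u = 1 \<and>
        (\<forall>t\<in>\<O>. (\<exists>y\<in>\<O>. t * y = 1) \<or> (\<exists>y\<in>\<O>. (1 - t) * y = 1)))"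
  shows "conjugation_order bar \<O> fixed_val"
proof
  show "1 \<in> \<O>"
    using emb_integral_iff[of 1] by (simp add: emb_one ring_1)
  show "\<exists>y. x * y = 1" if "bar x = x" "x \<noteq> 0" for x
    using fixed_emb[OF that(1)] emb_inverse that(2) by (metis emb_0)
  show "\<exists>c\<in>\<O>. y = c * x" if xy: "bar x = x" "bar y = y" "x \<noteq> 0" "y \<noteq> 0" "fixed_val x \<le> fixed_val y" for x y
  proof -
    obtain a b where ab: "x = \<iota> a" "y = \<iota> b"
      using fixed_emb xy by metis
    then have "b / a \<in> \<oo>"
      using xy by (auto simp: valuation_ring_def valuation_ge_def divide_inverse val_mult val_inverse)
    moreover have "y = \<iota> (b / a) * x"
      using ab xy by (simp flip: emb_mult)
    ultimately show ?thesis
      using emb_integral_iff by blast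
  qed
  show "(\<exists>y\<in>\<O>. x * y = 1) \<or> (\<exists>y\<in>\<O>. (1 - x) * y = 1)" if x: "bar x = x" "x \<in> \<O>" for x
  proof -
    have unit: "\<exists>y\<in>\<O>. \<iota> a * y = 1" if "a \<in> \<oo>" "a \<notin> \<pp>" for a
      using emb_inverse[of a] inverse_mem[OF that] emb_integral_iff that ideal_0 by metis
    obtain a where a: "x = \<iota> a"
      using fixed_emb x by metis
    then have "a \<in> \<oo>" "1 - a \<in> \<oo>" "1 - x = \<iota> (1 - a)"
      using x by (auto simp: emb_integral_iff emb_diff emb_one intro: ring_diff ring_1)
    moreover have "a \<notin> \<pp> \<or> 1 - a \<notin> \<pp>"
      using ideal_add[of a "1 - a"] one_notin_ideal by auto
    ultimately show ?thesis
      using unit a by metis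
  qed
  show "x = 0" if x: "\<And>a. a \<in> \<O> \<Longrightarrow> a * x + bar (a * x) = 0" for x
  proof (rule trace_form_nondeg)
    show "x + bar x = 0"
      using x[of 1] emb_integral_iff[of 1] by (simp add: emb_one ring_1)
    \<comment> \<open>\<open>\<theta>\<close> need not be integral, but a power of
      \<open>\<pi>\<close> makes it so and can be cancelled afterwards.\<close>
    obtain \<pi> where pi: "\<pi> \<noteq> 0" "v \<pi> = 1"
      using uniformizer_exists by blast
    then obtain m where "\<iota> (\<pi> ^ m) * \<theta> \<in> \<O>"
      using scale_integral[of \<pi> \<theta>] by blast
    from x[OF this] have "\<iota> (\<pi> ^ m) * (\<theta> * x + bar (\<theta> * x)) = 0"
      by (simp add: bar_mult bar_emb algebra_simps)
    then show "\<theta> * x + bar (\<theta> * x) = 0"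
      using emb_cancel[of "\<pi> ^ m" _ 0] pi(1) by simp
  qed
  show "x \<in> \<O>" if "\<And>a. a \<in> \<O> \<Longrightarrow> a * x + bar (a * x) \<in> \<O>" for x
    using that by (rule dual)
qed (rule bar_add bar_mult bar_bar' add mult bar_integral uminus_integral split_or_local; assumption)+

end

section \<open>The split case\<close>

text \<open>Trace 1 and norm 0 say that \<open>e\<close> is an idempotent with conjugate
  \<open>1 - e\<close>, like (1, 0) in the product of two copies of \<open>K\<close>.\<close>

locale split_quadratic = local_quadratic_generator v \<iota> bar e 1 0
  for v :: "'k::field \<Rightarrow> int" and \<iota> :: "'k \<Rightarrow> 'e::comm_ring_1" and bar e
begin

lemma bar_e: "bar e = 1 - e"
  using bar_generator by (simp add: emb_one)

lemma e_idem: "e * e = e"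
  using norm_generator by (simp add: bar_e algebra_simps)

lemma components: obtains a b where "x = \<iota> a * e + \<iota> b * (1 - e)"
proof -
  obtain a b where "x = \<iota> a + \<iota> b * e"
    using generator by blast
  then have "x = \<iota> (a + b) * e + \<iota> a * (1 - e)"
    by (simp add: emb_add algebra_simps)
  then show ?thesis
    by (rule that)
qed

text \<open>Trace and norm are the sum and product of the components, so the components are the
  roots of a monic integral quadratic polynomial, whose linear factors are integral.\<close>

lemma integral_components_iff: "\<iota> a * e + \<iota> b * (1 - e) \<in> \<O> \<longleftrightarrow> a \<in> \<oo> \<and> b \<in> \<oo>"
proof -
  define x where "x = \<iota> a * e + \<iota> b * (1 - e)"
  have tr: "x + bar x = \<iota> (a + b)"
    by (simp add: x_def bar_add bar_mult bar_emb bar_e bar_diff' emb_add algebra_simps)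
  have "x * bar x = \<iota> (a * b) * (e * e + (1 - e) * (1 - e)) + (\<iota> (a * a) + \<iota> (b * b)) * (e - e * e)"
    by (simp add: x_def bar_add bar_mult bar_emb bar_e bar_diff' emb_mult algebra_simps)
  then have nm: "x * bar x = \<iota> (a * b)"
    using e_idem by (simp add: algebra_simps)
  have "x \<in> \<O> \<longleftrightarrow> a + b \<in> \<oo> \<and> a * b \<in> \<oo>"
    by (auto simp: integral_iff tr nm)
  also have "\<dots> \<longleftrightarrow> a \<in> \<oo> \<and> b \<in> \<oo>"
  proof
    assume ab: "a + b \<in> \<oo> \<and> a * b \<in> \<oo>"
    have p: "[:a * b, - (a + b), 1:] = [:- a, 1:] * [:- b, 1:]"
      by (simp add: algebra_simps)
    have "coeff [:a * b, - (a + b), 1:] i \<in> \<oo>" for i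
      using ab ring_uminus[of "a + b"] ring_0 ring_1 by (auto simp: coeff_pCons split: nat.splits)
    from monic_factor_integral[OF p _ _ this, of 0] have "- a \<in> \<oo>"
      by simp
    then have "a \<in> \<oo>"
      using ring_uminus by fastforce
    then show "a \<in> \<oo> \<and> b \<in> \<oo>"
      using ab ring_diff[of "a + b" a] by simp
  qed (auto intro: ring_add ring_mult)
  finally show ?thesis
    by (simp add: x_def)
qed

lemma components_mult:
  "(\<iota> a * e + \<iota> b * (1 - e)) * (\<iota> c * e + \<iota> d * (1 - e)) = \<iota> (a * c) * e + \<iota> (b * d) * (1 - e)"
proof -
  have "(\<iota> a * e + \<iota> b * (1 - e)) * (\<iota> c * e + \<iota> d * (1 - e))
    = \<iota> (a * c) * (e * e) + \<iota> (b * d) * ((1 - e) * (1 - e)) + \<iota> (a * d + b * c) * (e - e * e)"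
    by (simp add: emb_mult emb_add algebra_simps)
  then show ?thesis
    using e_idem by (simp add: algebra_simps)
qed

lemma conjugation_order_split: "conjugation_order bar \<O> fixed_val"
proof (rule conjugation_order_integral)
  fix x y assume xy: "x \<in> \<O>" "y \<in> \<O>"
  obtain a b where x: "x = \<iota> a * e + \<iota> b * (1 - e)"
    using components by blast
  obtain c d where y: "y = \<iota> c * e + \<iota> d * (1 - e)"
    using components by blast
  have "x + y = \<iota> (a + c) * e + \<iota> (b + d) * (1 - e)"
    by (simp add: x y emb_add algebra_simps)
  then show "x + y \<in> \<O>"
    using xy by (simp only: x y integral_components_iff) (auto intro: ring_add)
  show "x * y \<in> \<O>"
    using xy by (simp only: x y components_mult integral_components_iff) (auto intro: ring_mult)
next
  have e: "e \<in> \<O>" "1 - e \<in> \<O>"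
    using integral_components_iff[of 1 0] integral_components_iff[of 0 1]
    by (simp_all add: emb_one ring_0 ring_1)
  then show "(\<exists>e\<in>\<O>. e * e = e \<and> bar e = 1 - e) \<or>
      (\<exists>u\<in>\<O>. (\<exists>u'\<in>\<O>. u * u' = 1) \<and> u + bar u = 1 \<and>
        (\<forall>t\<in>\<O>. (\<exists>y\<in>\<O>. t * y = 1) \<or> (\<exists>y\<in>\<O>. (1 - t) * y = 1)))"
    using e_idem bar_e by blast
  fix x assume x: "\<And>a. a \<in> \<O> \<Longrightarrow> a * x + bar (a * x) \<in> \<O>"
  obtain a b where ab: "x = \<iota> a * e + \<iota> b * (1 - e)"
    using components by blast
  \<comment> \<open>The traces of \<open>e * x\<close> and \<open>(1 - e) * x\<close> are the two
    components of \<open>x\<close>; these two tests already give self-duality.\<close>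
  have "e * x = \<iota> a * e" "(1 - e) * x = \<iota> b * (1 - e)"
    using components_mult[of 1 0 a b] components_mult[of 0 1 a b] by (simp_all add: ab emb_one)
  then have "e * x + bar (e * x) = \<iota> a * e + \<iota> a * (1 - e)"
      "(1 - e) * x + bar ((1 - e) * x) = \<iota> b * (1 - e) + \<iota> b * e"
    by (simp_all only: bar_mult bar_emb bar_diff' bar_e) simp
  then have "e * x + bar (e * x) = \<iota> a" "(1 - e) * x + bar ((1 - e) * x) = \<iota> b"
    by (simp_all flip: distrib_left)
  then have "a \<in> \<oo>" "b \<in> \<oo>"
    using x[OF e(1)] x[OF e(2)] by (simp_all add: emb_integral_iff)
  then show "x \<in> \<O>"
    by (simp add: ab integral_components_iff)
qed

end

section \<open>The unramified case\<close>

context nonarch_local_field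
begin

lemma finite_cosets: "finite ((\<lambda>a. (\<lambda>x. x + a) ` \<pp>) ` \<oo>)"
proof -
  have "carrier (subring_of_type \<oo> Quot \<pp>) = (\<lambda>a. (\<lambda>x. x + a) ` \<pp>) ` \<oo>"
    by (auto simp: FactRing_def A_RCOSETS_def' a_r_coset_def' subring_of_type_def)
  then show ?thesis
    using finite_residue_field by simp
qed

text \<open>Injectivity of Frobenius on the residue field, written with elements of
  \<open>\<oo>\<close>.\<close>

lemma ideal_of_squares_diff:
  assumes "2 \<in> \<pp>" "x \<in> \<oo>" "y \<in> \<oo>" "x\<^sup>2 - y\<^sup>2 \<in> \<pp>"
  shows "x - y \<in> \<pp>"
proof -
  have "(x - y) * (x - y) = (x\<^sup>2 - y\<^sup>2) - (y * (x - y)) * 2"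
    by (simp add: power2_eq_square algebra_simps)
  also have "\<dots> \<in> \<pp>"
    by (rule ideal_diff[OF assms(4) ideal_mult[OF ring_mult[OF assms(3) ring_diff] assms(1)]])
      (use assms in auto)
  finally show ?thesis
    using nonideal_mult ring_diff assms(2,3) by blast
qed

lemma ring_power: "x \<in> \<oo> \<Longrightarrow> x ^ n \<in> \<oo>"
  by (induction n) (auto intro: ring_1 ring_mult)

text \<open>In a finite field of characteristic 2 every element \<open>a\<close> is a square, because
  two of the elements \<open>a, a\<^sup>2, a\<^sup>4, \<dots>\<close> coincide and squaring is injective.\<close>

lemma residue_square:
  assumes two: "2 \<in> \<pp>" and a: "a \<in> \<oo>"
  shows "\<exists>b\<in>\<oo>. a - b\<^sup>2 \<in> \<pp>"
proof -
  define g where "g i = (\<lambda>x. x + a ^ (2 ^ i)) ` \<pp>" for i :: nat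
  have "range g \<subseteq> (\<lambda>a. (\<lambda>x. x + a) ` \<pp>) ` \<oo>"
    using ring_power[OF a] by (auto simp: g_def)
  then have "finite (range g)"
    using finite_cosets finite_subset by blast
  then have "\<not> inj g"
    using finite_imageD by auto
  then obtain i d where "d > 0" "g i = g (i + d)"
    by (metis (no_types, lifting) injI less_imp_add_positive nat_neq_iff)
  then have "0 + a ^ (2 ^ i) \<in> g (i + d)"
    using ideal_0 by (auto simp: g_def)
  then have "a ^ (2 ^ i) - a ^ (2 ^ (i + d)) \<in> \<pp>"
    by (auto simp: g_def)
  then have "a - a ^ (2 ^ d) \<in> \<pp>"
  proof (induction i)
    case (Suc i)
    have "(a ^ (2 ^ i))\<^sup>2 - (a ^ (2 ^ (i + d)))\<^sup>2 \<in> \<pp>"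
      using Suc.prems by (simp add: mult.commute flip: power_mult)
    from ideal_of_squares_diff[OF two _ _ this] show ?case
      using Suc.IH ring_power[OF a] by blast
  qed simp
  \<comment> \<open>With \<open>d > 0\<close> the power \<open>a ^ (2 ^ d)\<close> is a square, and
    it is congruent to \<open>a\<close>.\<close>
  moreover obtain d' where "d = Suc d'"
    using \<open>d > 0\<close> by (cases d) auto
  ultimately have "a - (a ^ (2 ^ d'))\<^sup>2 \<in> \<pp>"
    by (simp add: mult.commute flip: power_mult)
  then show ?thesis
    using ring_power[OF a] by blast
qed

end

lemma ideal_of_type:
  assumes "ring (subring_of_type A)" "I \<subseteq> A" "0 \<in> I"
    and "\<And>x y. x \<in> I \<Longrightarrow> y \<in> I \<Longrightarrow> x + y \<in> I" "\<And>a x. a \<in> A \<Longrightarrow> x \<in> I \<Longrightarrow> a * x \<in> I"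
  shows "ideal I (subring_of_type A)"
proof -
  interpret ring "subring_of_type A" by fact
  have simps [simp]: "carrier (subring_of_type A) = A" "x \<oplus>\<^bsub>subring_of_type A\<^esub> y = x + y"
    "x \<otimes>\<^bsub>subring_of_type A\<^esub> y = x * y" "\<zero>\<^bsub>subring_of_type A\<^esub> = 0" "\<one>\<^bsub>subring_of_type A\<^esub> = 1" for x y
    by (simp_all add: subring_of_type_def)
  have neg: "\<ominus>\<^bsub>subring_of_type A\<^esub> x = - x \<and> - x \<in> A" if "x \<in> A" for x
    using l_neg[of x] a_inv_closed[of x] that by simp (metis eq_neg_iff_add_eq_0)
  have one: "1 \<in> A"
    using one_closed by simp
  have "- x \<in> I" if "x \<in> I" for x
    using assms(5)[of "- 1" x] neg[OF one] that by simp
  then have "subgroup I (add_monoid (subring_of_type A))"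
    using assms(2-4) neg by (auto simp: subgroup_def a_inv_def)
  moreover have "x * a \<in> I" if "a \<in> A" "x \<in> I" for a x
    using assms(5)[OF that] by (simp add: mult.commute)
  ultimately show ?thesis
    using assms(1,5) by (intro idealI) auto
qed

locale unramified_quadratic = local_quadratic_generator v \<iota> bar \<theta> t n
  for v :: "'k::field \<Rightarrow> int" and \<iota> :: "'k \<Rightarrow> 'e::comm_ring_1" and bar \<theta> t n +
  assumes invertible: "(x :: 'e) \<noteq> 0 \<Longrightarrow> \<exists>y. x * y = 1"
    and maximal: "maximalideal (genideal (subring_of_type \<O>) (\<iota> ` \<pp>)) (subring_of_type \<O>)"
  fixes \<pi>
  assumes pi: "\<pi> \<noteq> 0" "v \<pi> = 1"
begin

text \<open>\<open>maximalideal\<close> contains the ring axioms, so closure of \<open>\<O>\<close>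
  under sums and products can be read off from unramifiedness.\<close>

lemma ring_integral: "ring (subring_of_type \<O>)"
  using maximal by (simp add: maximalideal_def ideal_def)

lemma add_integral: "x \<in> \<O> \<Longrightarrow> y \<in> \<O> \<Longrightarrow> x + y \<in> \<O>"
  using ring.ring_simprules(1)[OF ring_integral] by (simp add: subring_of_type_def)

lemma mult_integral: "x \<in> \<O> \<Longrightarrow> y \<in> \<O> \<Longrightarrow> x * y \<in> \<O>"
  using ring.ring_simprules(5)[OF ring_integral] by (simp add: subring_of_type_def)

lemma diff_integral: "x \<in> \<O> \<Longrightarrow> y \<in> \<O> \<Longrightarrow> x - y \<in> \<O>"
  using add_integral[OF _ uminus_integral, of x y] by simp

lemma one_integral: "1 \<in> \<O>"
  using emb_integral_iff[of 1] by (simp add: emb_one ring_1)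

lemma zero_integral: "0 \<in> \<O>"
  using emb_integral_iff[of 0] by (simp add: ring_0)

lemma pi_integral: "\<iota> \<pi> \<in> \<O>"
  using pi by (simp add: emb_integral_iff valuation_ring_def valuation_ge_def)

lemma pi_ideal: "\<pi> \<in> \<pp>"
  using pi by (simp add: valuation_ideal_def valuation_ge_def)

definition P :: "'e set" where
  "P = (\<lambda>z. \<iota> \<pi> * z) ` \<O>"

lemma P_subset: "P \<subseteq> \<O>"
  using mult_integral pi_integral by (auto simp: P_def)

lemma P_0: "0 \<in> P"
  unfolding P_def using zero_integral by (intro image_eqI[of _ _ 0]) auto

lemma P_add: "x \<in> P \<Longrightarrow> y \<in> P \<Longrightarrow> x + y \<in> P"
  using add_integral by (auto simp: P_def simp flip: distrib_left)

lemma P_mult: "a \<in> \<O> \<Longrightarrow> x \<in> P \<Longrightarrow> a * x \<in> P"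
  using mult_integral by (auto simp: P_def mult.left_commute[of a])

lemma P_emb: "a \<in> \<pp> \<Longrightarrow> \<iota> a \<in> P"
  using ideal_uniformizer[OF pi] emb_integral_iff by (metis P_def emb_mult imageI)

lemma genideal_eq_P: "genideal (subring_of_type \<O>) (\<iota> ` \<pp>) = P"
proof
  interpret ring "subring_of_type \<O>" by (rule ring_integral)
  have I: "ideal P (subring_of_type \<O>)"
    by (intro ideal_of_type ring_integral P_subset P_0 P_add P_mult)
  show "genideal (subring_of_type \<O>) (\<iota> ` \<pp>) \<subseteq> P"
    using P_emb by (intro genideal_minimal I) auto
  have sub: "\<iota> ` \<pp> \<subseteq> carrier (subring_of_type \<O>)"
    using P_emb P_subset by (auto simp: subring_of_type_def)
  interpret G: ideal "genideal (subring_of_type \<O>) (\<iota> ` \<pp>)" "subring_of_type \<O>"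
    using genideal_ideal[OF sub] .
  have "\<iota> \<pi> \<in> genideal (subring_of_type \<O>) (\<iota> ` \<pp>)"
    using genideal_self[OF sub] pi_ideal by blast
  then show "P \<subseteq> genideal (subring_of_type \<O>) (\<iota> ` \<pp>)"
    using G.I_r_closed by (auto simp: P_def subring_of_type_def)
qed

lemmas maximal_P = maximal[unfolded genideal_eq_P]

lemma one_notin_P: "1 \<notin> P"
proof
  assume "1 \<in> P"
  then have "\<O> \<subseteq> P"
    using P_mult by fastforce
  then show False
    using maximalideal.I_notcarr[OF maximal_P] P_subset by (simp add: subring_of_type_def)
qed

lemma P_diff: "x \<in> P \<Longrightarrow> y \<in> P \<Longrightarrow> x - y \<in> P"
  using P_add[of x "- 1 * y"] P_mult[of "- 1" y] uminus_integral[OF one_integral] by simp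

lemma unit_of_norm:
  assumes x: "x \<in> \<O>" and a: "x * bar x = \<iota> a" "a \<notin> \<pp>"
  shows "\<exists>y\<in>\<O>. x * y = 1"
proof -
  have "a \<in> \<oo>" "a \<noteq> 0"
    using x a ideal_0 by (auto simp: integral_iff)
  then have i: "\<iota> (inverse a) \<in> \<O>" "\<iota> a * \<iota> (inverse a) = 1"
    using inverse_mem[of a] a(2) emb_inverse[of a] by (simp_all add: emb_integral_iff)
  have "x * (bar x * \<iota> (inverse a)) = 1"
    using a i by (simp flip: mult.assoc)
  then show ?thesis
    using mult_integral[OF bar_integral[OF x] i(1)] by blast
qed

text \<open>Maximality of \<open>P\<close> only makes \<open>x\<close> invertible modulo
  \<open>P\<close>, say \<open>y * x = 1 - \<iota> \<pi> * z\<close>. This element has a norm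
  congruent to 1 modulo \<open>\<pp>\<close>, hence is a unit. So \<open>\<O>\<close> is
  local.\<close>

lemma unit_of_notin_P:
  assumes x: "x \<in> \<O>" "x \<notin> P"
  shows "\<exists>y\<in>\<O>. x * y = 1"
proof -
  define J where "J = {z + y * x |z y. z \<in> P \<and> y \<in> \<O>}"
  have J_add: "r + s \<in> J" if rs: "r \<in> J" "s \<in> J" for r s
  proof -
    obtain z y z' y' where *: "r = z + y * x" "s = z' + y' * x" "z \<in> P" "z' \<in> P" "y \<in> \<O>" "y' \<in> \<O>"
      using rs unfolding J_def by blast
    then have "r + s = (z + z') + (y + y') * x"
      by (simp add: algebra_simps)
    then show ?thesis
      using * P_add add_integral unfolding J_def by blast
  qed
  have J_mult: "a * r \<in> J" if ar: "a \<in> \<O>" "r \<in> J" for a r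
  proof -
    obtain z y where *: "r = z + y * x" "z \<in> P" "y \<in> \<O>"
      using ar unfolding J_def by blast
    then have "a * r = a * z + (a * y) * x"
      by (simp add: algebra_simps)
    then show ?thesis
      using * P_mult mult_integral ar unfolding J_def by blast
  qed
  have PJ: "P \<subseteq> J"
  proof
    fix z assume "z \<in> P"
    then have "z = z + 0 * x \<and> z \<in> P \<and> 0 \<in> \<O>"
      using zero_integral by simp
    then show "z \<in> J"
      unfolding J_def by blast
  qed
  have J_sub: "J \<subseteq> \<O>"
    using P_subset add_integral mult_integral x by (auto simp: J_def)
  have "x = 0 + 1 * x"
    by simp
  then have "x \<in> J"
    unfolding J_def using P_0 one_integral by blast
  then have "J \<noteq> P"
    using x by blast
  moreover have "ideal J (subring_of_type \<O>)"
    using PJ P_0 by (intro ideal_of_type ring_integral J_sub J_add J_mult) auto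
  ultimately have "J = \<O>"
    using maximalideal.I_maximal[OF maximal_P, of J] PJ J_sub by (simp add: subring_of_type_def)
  then have "1 \<in> J"
    using one_integral by simp
  then obtain p y where "1 = p + y * x" "p \<in> P" "y \<in> \<O>"
    unfolding J_def by blast
  then obtain z where zy: "1 = \<iota> \<pi> * z + y * x" "z \<in> \<O>" "y \<in> \<O>"
    unfolding P_def by blast
  then have yx: "y * x = 1 - \<iota> \<pi> * z"
    by (simp add: algebra_simps)
  obtain c d where cd: "z + bar z = \<iota> c" "z * bar z = \<iota> d" "c \<in> \<oo>" "d \<in> \<oo>"
    using zy(2) by (auto simp: integral_iff)
  have "y * x * bar (y * x) = 1 - \<iota> \<pi> * (z + bar z) + \<iota> \<pi> * \<iota> \<pi> * (z * bar z)"
    unfolding yx by (simp add: bar_diff' bar_mult bar_emb algebra_simps)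
  also have "\<dots> = \<iota> (1 - (c - \<pi> * d) * \<pi>)"
    by (simp add: cd emb_add emb_diff emb_mult emb_one algebra_simps)
  finally have nm: "y * x * bar (y * x) = \<iota> (1 - (c - \<pi> * d) * \<pi>)" .
  have "(c - \<pi> * d) * \<pi> \<in> \<pp>"
    using cd pi_ideal by (intro ideal_mult ring_diff ring_mult) (auto intro: ideal_subset)
  then have "1 - (c - \<pi> * d) * \<pi> \<notin> \<pp>"
    using one_notin_ideal ideal_add by (metis diff_add_cancel)
  from unit_of_norm[OF mult_integral[OF zy(3) x(1)] nm this] obtain y' where "y' \<in> \<O>" "y * x * y' = 1"
    by blast
  then have "x * (y * y') = 1" "y * y' \<in> \<O>"
    using zy mult_integral by (auto simp: ac_simps)
  then show ?thesis
    by blast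
qed

lemma square_in_P: "x \<in> \<O> \<Longrightarrow> x * x \<in> P \<Longrightarrow> x \<in> P"
  using unit_of_notin_P[of x] P_mult by (metis mult.commute mult.left_commute mult_1)

text \<open>If all traces lay in \<open>\<pp>\<close>, the residue fields would coincide, because squaring is onto in the
  smaller one; so \<open>x - bar x\<close> would be infinitely divisible for all integral \<open>x\<close>.\<close>

lemma exists_unit_trace:
  "\<exists>x\<in>\<O>. \<exists>a\<in>\<oo>. x + bar x = \<iota> a \<and> a \<notin> \<pp>"
proof (rule ccontr)
  assume no_unit: "\<not> ?thesis"
  have tr: "a \<in> \<pp>" if "x \<in> \<O>" "x + bar x = \<iota> a" for x a
  proof -
    have "a \<in> \<oo>"
      using add_integral[OF that(1) bar_integral[OF that(1)]] that(2) by (simp add: emb_integral_iff)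
    then show ?thesis
      using no_unit that by blast
  qed
  have two_emb: "1 + 1 = \<iota> 2"
    using emb_add[of 1 1] by (simp add: emb_one)
  then have "\<iota> 1 + bar (\<iota> 1) = \<iota> 2"
    by (simp add: bar_emb emb_one)
  then have two: "2 \<in> \<pp>"
    using tr emb_integral_iff ring_1 by blast
  have approx: "\<exists>a. \<exists>z\<in>\<O>. x = \<iota> a + \<iota> \<pi> * z" if x: "x \<in> \<O>" for x
  proof -
    obtain c d where cd: "c \<in> \<oo>" "d \<in> \<oo>" "x + bar x = \<iota> c" "x * bar x = \<iota> d"
      using x by (auto simp: integral_iff)
    obtain b where b: "b \<in> \<oo>" "d - b\<^sup>2 \<in> \<pp>"
      using residue_square[OF two cd(2)] by blast
    have ib: "\<iota> b \<in> \<O>"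
      using b by (simp add: emb_integral_iff)
    \<comment> \<open>Modulo \<open>P\<close> the trace of \<open>x\<close> and 2 vanish and the
      norm of \<open>x\<close> is the square of \<open>b\<close>, so the square of
      \<open>x - \<iota> b\<close> vanishes.\<close>
    have "(x - \<iota> b) * (x - \<iota> b) = x * (x + bar x) - (x * bar x - \<iota> b * \<iota> b) - (x * \<iota> b) * (1 + 1)"
      by (simp add: algebra_simps)
    also have "\<dots> = x * \<iota> c - \<iota> (d - b\<^sup>2) - (x * \<iota> b) * \<iota> 2"
      by (simp add: cd emb_diff emb_mult power2_eq_square flip: two_emb)
    also have "\<dots> \<in> P"
      using tr[OF x cd(3)] x ib b two by (intro P_diff P_mult P_emb mult_integral)
    finally have "x - \<iota> b \<in> P"
      using square_in_P diff_integral x ib by blast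
    then obtain z where "z \<in> \<O>" "x - \<iota> b = \<iota> \<pi> * z"
      by (auto simp: P_def)
    then show ?thesis
      by (metis add.commute diff_add_cancel)
  qed
  \<comment> \<open>The part of \<open>x\<close> in \<open>K\<close> cancels in
    \<open>x - bar x\<close>, so every approximation step yields another factor
    \<open>\<pi>\<close>.\<close>
  have div: "\<exists>z\<in>\<O>. x - bar x = \<iota> (\<pi> ^ k) * (z - bar z)" if "x \<in> \<O>" for x k
    using that
  proof (induction k arbitrary: x)
    case (Suc k)
    obtain a z where "z \<in> \<O>" "x = \<iota> a + \<iota> \<pi> * z"
      using approx[OF Suc.prems] by blast
    then have z: "z \<in> \<O>" "x - bar x = \<iota> \<pi> * (z - bar z)"
      by (simp_all add: bar_add bar_mult bar_emb algebra_simps)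
    obtain y where "y \<in> \<O>" "z - bar z = \<iota> (\<pi> ^ k) * (y - bar y)"
      using Suc.IH[OF z(1)] by blast
    then show ?case
      using z by (intro bexI[of _ y]) (simp_all add: emb_mult mult.assoc)
  qed (auto simp: emb_one)
  obtain m where "\<iota> (\<pi> ^ m) * \<theta> \<in> \<O>"
    using scale_integral[OF pi, of \<theta>] by blast
  define x where "x = \<iota> (\<pi> ^ m) * \<theta>"
  have x: "x \<in> \<O>"
    unfolding x_def by fact
  obtain \<delta> where "(\<theta> - bar \<theta>) * \<delta> = 1"
    using disc_invertible by blast
  then have "x - bar x = \<iota> (\<pi> ^ m) * (\<theta> - bar \<theta>) \<and> \<theta> - bar \<theta> \<noteq> 0"
    using one_neq_0 by (auto simp: x_def bar_mult bar_emb algebra_simps)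
  then have "x - bar x \<noteq> 0"
    using emb_cancel[of "\<pi> ^ m" "\<theta> - bar \<theta>" 0] pi(1) by auto
  obtain y where y: "(x - bar x) * y = 1"
    using invertible[OF \<open>x - bar x \<noteq> 0\<close>] by blast
  obtain l where l: "\<iota> (\<pi> ^ l) * y \<in> \<O>"
    using scale_integral[OF pi, of y] by blast
  \<comment> \<open>\<open>\<pi> ^ l\<close> clears the denominator of the inverse \<open>y\<close>;
    the additional factor from \<open>Suc l\<close> puts 1 into \<open>P\<close>.\<close>
  obtain z where z: "z \<in> \<O>" "x - bar x = \<iota> (\<pi> ^ Suc l) * (z - bar z)"
    using div[OF x] by blast
  have "1 = \<iota> \<pi> * ((z - bar z) * (\<iota> (\<pi> ^ l) * y))"
    using y by (simp add: z(2) emb_mult ac_simps)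
  then have "1 \<in> P"
    using mult_integral[OF diff_integral[OF z(1) bar_integral[OF z(1)]] l] by (auto simp: P_def)
  then show False
    using one_notin_P by simp
qed

text \<open>Dividing an integral element of unit trace by its trace gives \<open>u\<close>. For
  self-duality, a non-integral \<open>x\<close> is a unit \<open>c\<close> divided by some
  \<open>\<pi> ^ m\<close> with \<open>m > 0\<close>; testing with \<open>u\<close> times the
  inverse of \<open>c\<close> gives a trace that is the inverse of \<open>\<pi> ^ m\<close>, which
  is not integral.\<close>

lemma conjugation_order_unramified: "conjugation_order bar \<O> fixed_val"
proof -
  obtain x a where x: "x \<in> \<O>" "x + bar x = \<iota> a" "a \<in> \<oo>" "a \<notin> \<pp>"
    using exists_unit_trace by blast
  have a0: "a \<noteq> 0"
    using x ideal_0 by auto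
  define u where "u = \<iota> (inverse a) * x"
  have u: "u \<in> \<O>" "u + bar u = 1"
  proof -
    show "u \<in> \<O>"
      using x inverse_mem by (auto simp: u_def emb_integral_iff intro: mult_integral)
    have "u + bar u = \<iota> (inverse a) * (x + bar x)"
      by (simp add: u_def bar_mult bar_emb algebra_simps)
    then show "u + bar u = 1"
      using emb_inverse[OF a0] by (simp add: x mult.commute)
  qed
  have "u \<notin> P"
  proof
    assume "u \<in> P"
    then obtain z where "z \<in> \<O>" "u = \<iota> \<pi> * z"
      by (auto simp: P_def)
    then have "1 = \<iota> \<pi> * (z + bar z)" "z + bar z \<in> \<O>"
      using u by (auto simp: bar_mult bar_emb distrib_left intro: add_integral bar_integral)
    then show False
      using one_notin_P unfolding P_def by blast
  qed
  then obtain u' where u': "u' \<in> \<O>" "u * u' = 1"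
    using unit_of_notin_P u by blast
  have loc: "(\<exists>y\<in>\<O>. s * y = 1) \<or> (\<exists>y\<in>\<O>. (1 - s) * y = 1)" if "s \<in> \<O>" for s
    using unit_of_notin_P[OF that] unit_of_notin_P[OF diff_integral[OF one_integral that]]
      P_add[of s "1 - s"] one_notin_P by auto
  show ?thesis
  proof (rule conjugation_order_integral)
    fix x assume tr: "\<And>a. a \<in> \<O> \<Longrightarrow> a * x + bar (a * x) \<in> \<O>"
    show "x \<in> \<O>"
    proof (rule ccontr)
      assume nx: "x \<notin> \<O>"
      define m where "m = (LEAST m. \<iota> (\<pi> ^ m) * x \<in> \<O>)"
      define c where "c = \<iota> (\<pi> ^ m) * x"
      have c: "c \<in> \<O>"
        unfolding c_def m_def using scale_integral[OF pi, of x] by (metis LeastI order_refl)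
      then obtain k where k: "m = Suc k"
        using nx by (cases m) (auto simp: c_def emb_one)
      have "\<iota> (\<pi> ^ k) * x \<notin> \<O>"
        using not_less_Least[of k "\<lambda>m. \<iota> (\<pi> ^ m) * x \<in> \<O>"] k by (simp add: m_def)
      moreover have "\<iota> (\<pi> ^ k) * x = z" if "c = \<iota> \<pi> * z" for z
      proof -
        have "\<iota> \<pi> * (\<iota> (\<pi> ^ k) * x) = \<iota> \<pi> * z"
          using that by (simp add: c_def k emb_mult mult.assoc)
        then show ?thesis
          by (rule emb_cancel[OF pi(1)])
      qed
      ultimately have "c \<notin> P"
        by (auto simp: P_def)
      then obtain c' where c': "c' \<in> \<O>" "c * c' = 1"
        using unit_of_notin_P c by blast
      define y where "y = u * c' * x + bar (u * c' * x)"
      have "\<iota> (\<pi> ^ m) * y = u * (c * c') + bar (u * (c * c'))"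
        by (simp add: y_def c_def bar_mult bar_emb algebra_simps)
      then have "\<iota> (\<pi> ^ m) * y = 1"
        using c' u by simp
      then have "1 = \<iota> \<pi> * (\<iota> (\<pi> ^ k) * y)"
        by (simp add: k emb_mult mult.assoc)
      moreover have "\<iota> (\<pi> ^ k) * y \<in> \<O>"
        unfolding y_def using tr[OF mult_integral[OF u(1) c'(1)]] ring_power[OF ideal_subset[OF pi_ideal]]
        by (intro mult_integral) (auto simp: emb_integral_iff)
      ultimately have "1 \<in> P"
        unfolding P_def by blast
      then show False
        using one_notin_P by simp
    qed
  qed (use add_integral mult_integral u u' loc in blast)+
qed

end

section \<open>The unitary group of a lattice\<close>

lemma (in hermitian_space) group_lattice_unitary_group:
  "group (lattice_unitary_group scale form L)"
proof (rule groupI)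
  fix f assume "f \<in> carrier (lattice_unitary_group scale form L)"
  then have f: "module_hom scale scale f" "bij f" "\<And>x y. form (f x) (f y) = form x y" "f ` L = L"
    by (auto simp: lattice_unitary_group_def unitary_group_def)
  interpret f: module_hom scale scale f by fact
  define g where "g = inv_into UNIV f"
  have fi: "f (g x) = x" "g (f x) = x" for x
    using f(2) by (auto simp: g_def bij_def surj_f_inv_f)
  have "module_hom scale scale (g)"
  proof unfold_locales
    show "g (x + y) = g x + g y" for x y
      by (metis f.add fi)
    show "g (scale c x) = scale c (g x)" for c x
      by (metis f.scale fi)
  qed
  moreover have "bij (g)"
    unfolding g_def using f(2) by (rule bij_imp_bij_inv)
  moreover have "form (g x) (g y) = form x y" for x y
    using f(3)[of "g x" "g y"] by (simp add: fi)
  moreover have "g ` L = L"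
  proof -
    have "g ` L = g ` (f ` L)"
      using f(4) by simp
    then show ?thesis
      by (simp add: image_image fi)
  qed
  ultimately have "g \<in> carrier (lattice_unitary_group scale form L)"
    by (simp add: lattice_unitary_group_def unitary_group_def)
  then show "\<exists>g\<in>carrier (lattice_unitary_group scale form L).
      g \<otimes>\<^bsub>lattice_unitary_group scale form L\<^esub> f = \<one>\<^bsub>lattice_unitary_group scale form L\<^esub>"
    using fi by (intro bexI[of _ "g"]) (auto simp: lattice_unitary_group_def)
next
  fix f g assume "f \<in> carrier (lattice_unitary_group scale form L)"
    "g \<in> carrier (lattice_unitary_group scale form L)"
  then have fg: "f \<in> unitary_group scale form" "g \<in> unitary_group scale form" "f ` L = L" "g ` L = L"
    by (auto simp: lattice_unitary_group_def)
  then have "(f \<circ> g) ` L = L"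
    by (metis image_comp)
  moreover have "f \<circ> g \<in> unitary_group scale form"
    using fg(1,2) by (auto simp: unitary_group_def intro: module_hom_compose bij_comp)
  ultimately show "f \<otimes>\<^bsub>lattice_unitary_group scale form L\<^esub> g
      \<in> carrier (lattice_unitary_group scale form L)"
    by (simp add: lattice_unitary_group_def)
next
  have "module_hom scale scale id"
    by unfold_locales auto
  then show "\<one>\<^bsub>lattice_unitary_group scale form L\<^esub> \<in> carrier (lattice_unitary_group scale form L)"
    by (simp add: lattice_unitary_group_def unitary_group_def)
qed (auto simp: lattice_unitary_group_def comp_assoc)

text \<open>The dimension is counted over \<open>K\<close>, since the algebra may fail to be a
  field: orthogonal vectors with invertible norms are independent over \<open>K\<close>, and
  \<open>B\<close> together with its multiples by \<open>\<theta>\<close> spans over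
  \<open>K\<close>.\<close>

lemma (in quadratic_generator) orthogonal_card_bound:
  fixes scale :: "'e \<Rightarrow> 'v::ab_group_add \<Rightarrow> 'v"
  assumes "hermitian_space scale bar form"
  obtains N where "\<And>X. finite X \<Longrightarrow> (\<And>x y. x \<in> X \<Longrightarrow> y \<in> X \<Longrightarrow> x \<noteq> y \<Longrightarrow> form x y = 0) \<Longrightarrow>
    (\<And>x. x \<in> X \<Longrightarrow> \<exists>a. form x x * a = 1) \<Longrightarrow> card X \<le> N"
proof -
  interpret V: hermitian_space scale bar form by fact
  interpret K: vector_space "\<lambda>a. scale (\<iota> a)"
    by unfold_locales (simp_all add: V.scale_right_distrib V.scale_left_distrib emb_add emb_mult emb_one)
  obtain B where B: "finite B" "V.span B = UNIV"
    using V.finite_free by blast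
  define T where "T = B \<union> scale \<theta> ` B"
  have "x \<in> K.span T" for x
  proof -
    have "x \<in> V.span B"
      using B by simp
    then obtain c where "x = (\<Sum>b\<in>B. scale (c b) b)"
      using V.span_finite[OF B(1)] by auto
    moreover have "scale r b \<in> K.span T" if "b \<in> B" for r b
    proof -
      obtain p q where "r = \<iota> p + \<iota> q * \<theta>"
        using generator by blast
      then have "scale r b = scale (\<iota> p) b + scale (\<iota> q) (scale \<theta> b)"
        by (simp add: V.scale_left_distrib)
      moreover have "b \<in> K.span T" "scale \<theta> b \<in> K.span T"
        using that by (auto simp: T_def intro: K.span_base)
      ultimately show ?thesis
        using K.span_add[OF K.span_scale K.span_scale] by metis
    qed
    ultimately show ?thesis
      by (auto intro: K.span_sum)
  qed
  note T = this
  have "card X \<le> card T"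
    if X: "finite X" "\<And>x y. x \<in> X \<Longrightarrow> y \<in> X \<Longrightarrow> x \<noteq> y \<Longrightarrow> form x y = 0"
      "\<And>x. x \<in> X \<Longrightarrow> \<exists>a. form x x * a = 1" for X
  proof -
    have "K.independent X"
    proof (rule ccontr)
      assume "\<not> K.independent X"
      then obtain c y where c: "y \<in> X" "c y \<noteq> 0" "(\<Sum>x\<in>X. scale (\<iota> (c x)) x) = 0"
        using K.dependent_finite[OF X(1)] by blast
      interpret form: module_hom scale "(*)" "\<lambda>x. form x y"
        by (rule V.form_linear)
      have "0 = form (\<Sum>x\<in>X. scale (\<iota> (c x)) x) y"
        by (simp add: c)
      also have "\<dots> = (\<Sum>x\<in>X. \<iota> (c x) * form x y)"
        by (simp add: form.sum form.scale)
      also have "\<dots> = (\<Sum>x\<in>X. if x = y then \<iota> (c y) * form y y else 0)"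
        using X(2) c(1) by (intro sum.cong) auto
      also have "\<dots> = \<iota> (c y) * form y y"
        using X(1) c(1) by simp
      finally have "\<iota> (c y) * form y y = 0"
        by simp
      then have "\<iota> (c y) = 0"
        using X(3)[OF c(1)] by (metis mult.assoc mult.right_neutral mult_zero_left)
      then show False
        using c(2) by simp
    qed
    then show ?thesis
      using K.independent_span_bound[of T X] T B(1) by (auto simp: T_def)
  qed
  then show ?thesis
    by (rule that)
qed

context local_quadratic_generator
begin

lemma generated_by_symmetries:
  fixes scale :: "'e \<Rightarrow> 'v::ab_group_add \<Rightarrow> 'v"
  assumes herm: "hermitian_space scale bar form"
    and ord: "conjugation_order bar \<O> fixed_val" and whole: "conjugation_order bar UNIV (\<lambda>_. 0)"
    and nondeg: "nondegenerate_on form UNIV" and fg: "fg_submodule scale \<O> L"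
    and nondeg_L: "nondegenerate_on form L"
  shows "carrier (lattice_unitary_group scale form L) = symmetry_subgroup scale bar form L"
proof -
  interpret O: hermitian_order scale bar form \<O> fixed_val
    using herm ord by (rule hermitian_order.intro)
  interpret V: hermitian_order scale bar form UNIV "\<lambda>_. 0"
    using herm whole by (rule hermitian_order.intro)
  define G where "G = lattice_unitary_group scale form L"
  define H where "H = symmetry_subgroup scale bar form L"
  interpret G: group G
    unfolding G_def by (rule O.group_lattice_unitary_group)
  have G_iff: "f \<in> carrier G \<longleftrightarrow> f \<in> unitary_group scale form \<and> f ` L = L" for f
    by (simp add: G_def lattice_unitary_group_def)
  have G_mult: "f \<otimes>\<^bsub>G\<^esub> g = f \<circ> g" and G_one: "\<one>\<^bsub>G\<^esub> = id" for f g
    by (simp_all add: G_def lattice_unitary_group_def)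
  have H_gen: "H = generate G (symmetries scale bar form \<inter> carrier G)"
    by (simp add: H_def symmetry_subgroup_def G_def)
  have H_sub: "H \<subseteq> carrier G"
    unfolding H_gen by (rule G.generate_incl) auto
  have H_comp: "f \<circ> g \<in> H" if "f \<in> H" "g \<in> H" for f g
    using generate.eng[of f G _ g] that unfolding H_gen G_mult by blast
  have H_id: "id \<in> H"
    using generate.one[of G] unfolding H_gen G_one by blast
  have H_sym: "symmetry scale form s \<sigma> \<in> H"
    if "\<sigma> * \<tau> = 1" "form s s = trace bar \<sigma>" "symmetry scale form s \<sigma> ` L = L" for s \<sigma> \<tau>
  proof -
    have "symmetry scale form s \<sigma> \<in> symmetries scale bar form \<inter> carrier G"
      using that O.symmetry_unitary[OF that(1,2)]
      by (auto simp: symmetries_def G_iff) (metis dvdI)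
    then show ?thesis
      unfolding H_gen by (rule generate.incl)
  qed
  have unitary: "module_hom scale scale f" "form (f x) (f y) = form x y" "x \<in> L \<Longrightarrow> f x \<in> L"
    if "f \<in> carrier G" for f x y
    using that by (auto simp: G_iff unitary_group_def)
  obtain S where S: "finite S" "L = {(\<Sum>x\<in>S. scale (c x) x) |c. \<forall>x\<in>S. c x \<in> \<O>}"
    using fg by (auto simp: fg_submodule_def)
  have sub: "O.submodule_over \<O> L"
    unfolding O.submodule_over_def
  proof (intro conjI ballI)
    fix x y assume "x \<in> L" "y \<in> L"
    then obtain c d where "x = (\<Sum>x\<in>S. scale (c x) x)" "y = (\<Sum>x\<in>S. scale (d x) x)"
      and cd: "\<forall>x\<in>S. c x \<in> \<O>" "\<forall>x\<in>S. d x \<in> \<O>"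
      unfolding S(2) by blast
    then have "x + y = (\<Sum>x\<in>S. scale (c x + d x) x)"
      by (simp add: O.scale_left_distrib sum.distrib)
    moreover have "\<forall>x\<in>S. c x + d x \<in> \<O>"
      using cd by (auto intro: O.add_mem)
    ultimately show "x + y \<in> L"
      unfolding S(2) by (intro CollectI exI[of _ "\<lambda>x. c x + d x"] conjI)
  next
    fix r x assume r: "r \<in> \<O>" and "x \<in> L"
    then obtain c where "x = (\<Sum>x\<in>S. scale (c x) x)" and c: "\<forall>x\<in>S. c x \<in> \<O>"
      unfolding S(2) by blast
    then have "scale r x = (\<Sum>x\<in>S. scale (r * c x) x)"
      by (simp add: O.scale_sum_right)
    moreover have "\<forall>x\<in>S. r * c x \<in> \<O>"
      using c r by (auto intro: O.mult_mem)
    ultimately show "scale r x \<in> L"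
      unfolding S(2) by (intro CollectI exI[of _ "\<lambda>x. r * c x"] conjI)
  qed
  have zero: "0 \<in> L"
  proof -
    have "0 = (\<Sum>x\<in>S. scale 0 x)" "\<forall>x\<in>S. 0 \<in> \<O>"
      using O.zero_mem by simp_all
    then show ?thesis
      unfolding S(2) by (intro CollectI exI[of _ "\<lambda>_. 0"] conjI)
  qed
  obtain N where N: "\<And>X. O.orthogonal_family X \<Longrightarrow> card X \<le> N"
  proof -
    obtain N where N: "\<And>X. finite X \<Longrightarrow> (\<And>x y. x \<in> X \<Longrightarrow> y \<in> X \<Longrightarrow> x \<noteq> y \<Longrightarrow> form x y = 0) \<Longrightarrow>
        (\<And>x. x \<in> X \<Longrightarrow> \<exists>a. form x x * a = 1) \<Longrightarrow> card X \<le> N"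
      using orthogonal_card_bound[OF herm] by blast
    have "card X \<le> N" if "O.orthogonal_family X" for X
      using that by (intro N) (auto simp: O.orthogonal_family_def)
    then show thesis
      by (rule that)
  qed
  \<comment> \<open>Finite generation gives a common denominator \<open>\<pi> ^ M\<close> for all
    values of the form on \<open>L\<close>, hence the lower bound \<open>- int M\<close> for the
    traces.\<close>
  obtain B where B: "\<And>y z. y \<in> L \<Longrightarrow> z \<in> L \<Longrightarrow> trace bar (form y z) \<noteq> 0 \<Longrightarrow>
      B \<le> fixed_val (trace bar (form y z))"
  proof -
    obtain \<pi> where pi: "\<pi> \<noteq> 0" "v \<pi> = 1"
      using uniformizer_exists by blast
    define m where "m p = (SOME m. \<forall>k\<ge>m. \<iota> (\<pi> ^ k) * form (fst p) (snd p) \<in> \<O>)" for p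
    have m: "\<iota> (\<pi> ^ k) * form x y \<in> \<O>" if "k \<ge> m (x, y)" for x y k
      using someI_ex[OF scale_integral[OF pi, of "form x y"]] that by (simp add: m_def)
    define M where "M = sum m (S \<times> S)"
    have "m p \<le> M" if "p \<in> S \<times> S" for p
      unfolding M_def using that S(1) by (intro member_le_sum) auto
    then have M: "\<iota> (\<pi> ^ M) * form x y \<in> \<O>" if "x \<in> S" "y \<in> S" for x y
      using that m by blast
    have O_sum: "(\<Sum>i\<in>I. g i) \<in> \<O>" if "\<And>i. i \<in> I \<Longrightarrow> g i \<in> \<O>" for g :: "'v \<Rightarrow> 'e" and I
      using that by (induction I rule: infinite_finite_induct) (auto intro: O.mem_intros)
    have LS: "\<iota> (\<pi> ^ M) * form y s \<in> \<O>" if "y \<in> L" "s \<in> S" for y s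
    proof -
      obtain c where c: "y = (\<Sum>x\<in>S. scale (c x) x)" "\<forall>x\<in>S. c x \<in> \<O>"
        using \<open>y \<in> L\<close> unfolding S(2) by blast
      have "\<iota> (\<pi> ^ M) * form y s = (\<Sum>x\<in>S. c x * (\<iota> (\<pi> ^ M) * form x s))"
        by (simp add: c(1) O.form_sum_left O.form_scale_left sum_distrib_left mult.left_commute)
      also have "\<dots> \<in> \<O>"
        using c \<open>s \<in> S\<close> by (intro O_sum O.mult_mem[OF _ M]) auto
      finally show ?thesis .
    qed
    have LL: "\<iota> (\<pi> ^ M) * form y z \<in> \<O>" if "y \<in> L" "z \<in> L" for y z
    proof -
      obtain c where c: "z = (\<Sum>x\<in>S. scale (c x) x)" "\<forall>x\<in>S. c x \<in> \<O>"
        using \<open>z \<in> L\<close> unfolding S(2) by blast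
      have "\<iota> (\<pi> ^ M) * form z y = (\<Sum>x\<in>S. c x * bar (\<iota> (\<pi> ^ M) * form y x))"
        by (simp add: c(1) O.form_sum_left O.form_scale_left sum_distrib_left mult.left_commute
            bar_mult bar_emb flip: O.form_hermitian)
      also have "\<dots> \<in> \<O>"
        using c \<open>y \<in> L\<close> by (intro O_sum O.mult_mem[OF _ O.bar_mem[OF LS]]) auto
      finally have "bar (\<iota> (\<pi> ^ M) * form z y) \<in> \<O>"
        by (rule O.bar_mem)
      then show ?thesis
        by (simp add: bar_mult bar_emb flip: O.form_hermitian)
    qed
    have "- int M \<le> fixed_val (trace bar (form y z))"
      if yz: "y \<in> L" "z \<in> L" and nz: "trace bar (form y z) \<noteq> 0" for y z
    proof -
      obtain a where a: "trace bar (form y z) = \<iota> a"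
        unfolding trace_def using trace_emb by metis
      obtain b where b: "b \<in> \<oo>" "\<iota> (\<pi> ^ M) * form y z + bar (\<iota> (\<pi> ^ M) * form y z) = \<iota> b"
        using trace_integral[OF LL[OF yz]] by blast
      have "\<iota> b = \<iota> (\<pi> ^ M) * \<iota> a"
        unfolding b(2)[symmetric] a[symmetric] by (simp add: trace_def bar_mult bar_emb distrib_left)
      then have "b = \<pi> ^ M * a"
        by (simp flip: emb_mult)
      then show ?thesis
        using b(1) pi nz a
        by (auto simp: valuation_ring_def valuation_ge_def val_mult val_power)
    qed
    then show thesis
      by (rule that)
  qed
  have "f \<in> H" if f: "f \<in> carrier G" for f
  proof -
    have "\<exists>h\<in>H. \<exists>X. O.splits X L \<and> O.perp X L \<subseteq> {0} \<and> (\<forall>x\<in>X. h (f x) = x)"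
    proof (rule O.reduce_to_fixing[OF sub zero nondeg_L B N _ H_comp H_id])
      show "symmetry scale form s \<sigma> \<in> H" if adm: "O.admissible L s \<sigma>" for s \<sigma>
        using O.admissible_image[OF sub adm] adm H_sym by (auto simp: O.admissible_def)
    qed (use unitary[OF f] unitary[OF subsetD[OF H_sub]] in auto)
    then obtain h X where h: "h \<in> H" and X: "O.splits X L" "O.perp X L \<subseteq> {0}"
      "\<And>x. x \<in> X \<Longrightarrow> (h \<circ> f) x = x"
      by auto
    have hf: "h \<circ> f \<in> carrier G"
      using G.m_closed[of h f] H_sub h f by (auto simp: G_mult)
    have X': "O.orthogonal_family X" "X \<subseteq> L"
      using X(1) by (auto simp: O.splits_def)
    have fix_L: "(h \<circ> f) y = y" if "y \<in> L" for y
    proof -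
      have "(h \<circ> f) (O.projection X y) = O.projection X y"
        by (rule O.linear_fixes_projection[OF unitary(1)[OF hf]]) (rule X(3))
      then show ?thesis
        using O.projection_id[OF sub zero X(1,2) that] by simp
    qed
    \<comment> \<open>\<open>M\<close> is the complement of \<open>L\<close> in the whole space,
      hence a module over the algebra and not just over \<open>\<O>\<close>.\<close>
    define M where "M = {z. \<forall>y\<in>L. form z y = 0}"
    have M: "z - O.projection X z \<in> M" for z
      unfolding M_def
    proof (intro CollectI ballI)
      fix y assume y: "y \<in> L"
      have "form x (z - O.projection X z) = 0" if "x \<in> X" for x
        by (rule O.form_eq_0_sym) (simp add: O.form_diff_left O.form_projection[OF X'(1) that])
      then have "form (O.projection X y) (z - O.projection X z) = 0"
        by (rule O.form_projection_perp)
      then show "form (z - O.projection X z) y = 0"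
        using O.projection_id[OF sub zero X(1,2) y] O.form_eq_0_sym by simp
    qed
    define H' where "H' = {h \<in> H. \<forall>y\<in>L. h y = y}"
    have M_stable: "g x \<in> M" if g: "g \<in> carrier G" "\<And>y. y \<in> L \<Longrightarrow> g y = y" and "x \<in> M" for g x
      using unitary(2)[OF g(1), of x] g(2) \<open>x \<in> M\<close> by (auto simp: M_def) metis
    have sub_M: "O.submodule_over UNIV M"
      by (auto simp: O.submodule_over_def M_def O.form_simps)
    have zero_M: "0 \<in> M"
      by (simp add: M_def)
    have "\<exists>h'\<in>H'. \<exists>Y. V.splits Y M \<and> V.perp Y M \<subseteq> {0} \<and> (\<forall>y\<in>Y. h' ((h \<circ> f) y) = y)"
    \<comment> \<open>Over the whole algebra the valuation is constantly 0, hence the bound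
      0.\<close>
    proof (rule V.reduce_to_fixing[OF sub_M zero_M, where B = 0 and N = N])
      show "nondegenerate_on form M"
        unfolding nondegenerate_on_def
      proof (intro ballI impI)
        fix x assume x: "x \<in> M" "\<forall>y\<in>M. form x y = 0"
        \<comment> \<open>\<open>y\<close> is a combination of \<open>X\<close> plus a vector of
          \<open>M\<close>, and \<open>x\<close> is orthogonal to both.\<close>
        have "form x y = 0" for y
        proof -
          have "form (O.projection X y) x = 0"
          proof (rule O.form_projection_perp)
            fix s assume "s \<in> X"
            then have "form x s = 0"
              using x(1) X'(2) by (auto simp: M_def)
            then show "form s x = 0"
              by (rule O.form_eq_0_sym)
          qed
          then have "form x (O.projection X y) = 0"
            by (rule O.form_eq_0_sym)
          then show ?thesis
            using x(2) M[of y] by (auto simp: O.form_diff_right)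
        qed
        then show "x = 0"
          using nondeg by (simp add: nondegenerate_on_def)
      qed
      show "symmetry scale form s \<sigma> \<in> H'" if adm: "V.admissible M s \<sigma>" for s \<sigma>
      proof -
        obtain \<tau> where s: "s \<in> M" "form s s = trace bar \<sigma>" "\<sigma> * \<tau> = 1"
          using adm by (auto simp: V.admissible_def)
        \<comment> \<open>Since \<open>s\<close> is orthogonal to \<open>L\<close>, the symmetry
          preserves \<open>L\<close> for every invertible \<open>\<sigma>\<close> of the right
          trace.\<close>
        have "symmetry scale form s \<sigma> y = y" if "y \<in> L" for y
          using s(1) that O.form_eq_0_sym by (simp add: O.symmetry_eq[OF s(3)] M_def)
        then show ?thesis
          using H_sym[OF s(3,2)] by (auto simp: H'_def)
      qed
      show "f \<circ> g \<in> H'" if "f \<in> H'" "g \<in> H'" for f g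
        using H_comp that by (auto simp: H'_def)
      show "h x \<in> M" if "h \<in> H'" "x \<in> M" for h x
        using M_stable H_sub that by (auto simp: H'_def)
      show "form (h x) (h y) = form x y" if "h \<in> H'" for h x y
        using unitary(2) H_sub that by (auto simp: H'_def)
      show "(h \<circ> f) x \<in> M" if "x \<in> M" for x
        using M_stable[OF hf fix_L that] .
      show "form ((h \<circ> f) x) ((h \<circ> f) y) = form x y" for x y
        using unitary(2)[OF hf] .
    qed (use H_id N in \<open>auto simp: H'_def\<close>)
    then obtain h' Y where h': "h' \<in> H" "\<And>y. y \<in> L \<Longrightarrow> h' y = y" and Y: "V.splits Y M" "V.perp Y M \<subseteq> {0}"
      "\<And>y. y \<in> Y \<Longrightarrow> (h' \<circ> (h \<circ> f)) y = y"
      by (auto simp: H'_def)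
    define g where "g = h' \<circ> (h \<circ> f)"
    have g: "g \<in> carrier G"
      using G.m_closed[of h' "h \<circ> f"] H_sub h'(1) hf by (auto simp: G_mult g_def)
    interpret g: module_hom scale scale g
      using unitary(1)[OF g] .
    \<comment> \<open>The projection of \<open>z\<close> to the span of \<open>X\<close> is fixed
      because \<open>X\<close> lies in \<open>L\<close>; the rest lies in \<open>M\<close> and is a
      combination of the fixed family \<open>Y\<close>.\<close>
    have "g z = z" for z
    proof -
      have "g (V.projection Y (z - O.projection X z)) = V.projection Y (z - O.projection X z)"
        by (rule V.linear_fixes_projection[OF unitary(1)[OF g]]) (rule Y(3)[folded g_def])
      then have "g (z - O.projection X z) = z - O.projection X z"
        by (simp only: V.projection_id[OF sub_M zero_M Y(1,2) M])
      moreover have "g (O.projection X z) = O.projection X z"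
        using X'(2) fix_L h'(2) by (intro O.linear_fixes_projection unitary(1)[OF g]) (auto simp: g_def)
      ultimately show ?thesis
        by (simp add: g.diff)
    qed
    then have "(h' \<circ> h) \<otimes>\<^bsub>G\<^esub> f = \<one>\<^bsub>G\<^esub>"
      by (auto simp: G_mult G_one g_def)
    moreover have hh: "h' \<circ> h \<in> H"
      using H_comp h'(1) h by blast
    ultimately have "f = inv\<^bsub>G\<^esub> (h' \<circ> h)"
      using G.inv_equality f H_sub by (metis G.inv_inv subsetD)
    moreover have "inv\<^bsub>G\<^esub> (h' \<circ> h) \<in> H"
      using hh unfolding H_gen by (intro G.generate_m_inv_closed) auto
    ultimately show ?thesis
      by simp
  qed
  then show ?thesis
    using H_sub by (auto simp: G_def H_def)
qed

end

text \<open>\<open>bar e\<close> is one of four idempotents. It is neither 0 nor 1, by injectivity,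
  nor \<open>e\<close>, since then \<open>bar\<close> would be trivial; so it is the complementary
  idempotent.\<close>

lemma split_quadratic_exists:
  assumes "nonarch_local_field v" "quadratic_algebra \<iota> bar" "split_algebra \<iota>"
  shows "\<exists>e. split_quadratic v \<iota> bar e"
proof -
  interpret quadratic_algebra \<iota> bar by fact
  obtain \<phi> where \<phi>: "bij \<phi>"
      "\<And>x y. \<phi> (x + y) = (fst (\<phi> x) + fst (\<phi> y), snd (\<phi> x) + snd (\<phi> y))"
      "\<And>x y. \<phi> (x * y) = (fst (\<phi> x) * fst (\<phi> y), snd (\<phi> x) * snd (\<phi> y))"
      "\<And>a. \<phi> (\<iota> a) = (a, a)"
    using assms(3) by (auto simp: split_algebra_def)
  have inj: "x = y" if "\<phi> x = \<phi> y" for x y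
    using \<phi>(1) that by (auto simp: bij_def inj_def)
  have \<phi>01: "\<phi> 0 = (0, 0)" "\<phi> 1 = (1, 1)"
    using \<phi>(4)[of 0] \<phi>(4)[of 1] by (simp_all add: emb_one)
  obtain e where e: "\<phi> e = (1, 0)"
    using \<phi>(1) by (metis bij_def surjD)
  have gen: "\<exists>a b. x = \<iota> a + \<iota> b * e" for x
    by (intro exI[of _ "snd (\<phi> x)"] exI[of _ "fst (\<phi> x) - snd (\<phi> x)"] inj)
      (simp add: \<phi> e)
  have ee: "e * e = e"
    by (rule inj) (simp add: \<phi> e)
  then have "bar e * bar e = bar e"
    by (metis bar_mult)
  from arg_cong[OF this, of \<phi>] obtain c d where cd: "\<phi> (bar e) = (c, d)" "c * c = c" "d * d = d"
    by (cases "\<phi> (bar e)") (auto simp: \<phi>)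
  have bar_inj: "x = y" if "bar x = bar y" for x y
    using bar_bij that by (auto simp: bij_def inj_def)
  have "e + bar e = 1"
  proof -
    have "c = 0 \<or> c = 1" "d = 0 \<or> d = 1"
      using cd by auto
    moreover have "(c, d) \<noteq> (0, 0)"
      using cd(1) inj[of "bar e" 0] bar_inj[of e 0] e \<phi>01 by auto
    moreover have "(c, d) \<noteq> (1, 1)"
      using cd(1) inj[of "bar e" 1] bar_inj[of e 1] e \<phi>01 by auto
    moreover have "(c, d) \<noteq> (1, 0)"
      using cd(1) inj[of "bar e" e] bar_generator_neq[OF gen] e by auto
    ultimately have "(c, d) = (0, 1)"
      by auto
    then show ?thesis
      using cd(1) by (intro inj) (simp add: \<phi> \<phi>01 e)
  qed
  then have bar_e: "bar e = 1 - e"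
    by (simp add: algebra_simps)
  have "(e - bar e) * (2 * e - 1) = 4 * (e * e - e) + 1"
    by (simp add: bar_e algebra_simps)
  then have "(e - bar e) * (2 * e - 1) = 1"
    using ee by simp
  moreover have "e * bar e = 0"
    using ee by (simp add: bar_e algebra_simps)
  ultimately have "quadratic_generator_axioms \<iota> bar e 1 0"
    using gen \<open>e + bar e = 1\<close> unfolding quadratic_generator_axioms_def emb_one emb_0 by blast
  then show ?thesis
    using assms(1,2)
    by (auto simp: split_quadratic_def local_quadratic_generator_def quadratic_generator_def)
qed

lemma unramified_quadratic_exists:
  fixes \<iota> :: "'k::field \<Rightarrow> 'e::comm_ring_1"
  assumes "nonarch_local_field v" "quadratic_algebra \<iota> bar" "unramified_field_extension v \<iota>"
  shows "\<exists>\<theta> t n \<pi>. unramified_quadratic v \<iota> bar \<theta> t n \<pi>"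
proof -
  interpret nonarch_local_field v by fact
  interpret quadratic_algebra \<iota> bar by fact
  have fld: "\<exists>y. x * y = 1" if "x \<noteq> 0" for x :: 'e
    using assms(3) that by (auto simp: unramified_field_extension_def)
  obtain \<theta> where gen: "\<And>x. \<exists>a b. x = \<iota> a + \<iota> b * \<theta>"
    using exists_generator by blast
  have ne: "\<theta> - bar \<theta> \<noteq> 0"
    using bar_generator_neq[OF gen] by auto
  obtain \<delta> where \<delta>: "(\<theta> - bar \<theta>) * \<delta> = 1"
    using fld[OF ne] by blast
  obtain p q where pq: "\<theta> * \<theta> = \<iota> p + \<iota> q * \<theta>"
    using gen by blast
  then have "bar \<theta> * bar \<theta> = \<iota> p + \<iota> q * bar \<theta>"
    by (metis bar_add bar_mult bar_emb)
  \<comment> \<open>\<open>\<theta>\<close> and \<open>bar \<theta>\<close> satisfy the same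
    quadratic equation over \<open>K\<close>; subtract and cancel the invertible difference.\<close>
  then have "(\<theta> - bar \<theta>) * (\<theta> + bar \<theta> - \<iota> q) = 0"
    using pq by (simp add: algebra_simps)
  then have "\<delta> * (\<theta> - bar \<theta>) * (\<theta> + bar \<theta> - \<iota> q) = 0"
    by (simp add: mult.assoc)
  then have tr: "\<theta> + bar \<theta> = \<iota> q"
    using \<delta> by (simp add: mult.commute)
  then have bar_t: "bar \<theta> = \<iota> q - \<theta>"
    by (simp add: algebra_simps)
  have nm: "\<theta> * bar \<theta> = \<iota> (- p)"
    using pq by (simp add: bar_t emb_uminus algebra_simps)
  obtain \<pi> where pi: "\<pi> \<noteq> 0" "v \<pi> = 1"
    using val_normalised by blast
  have "quadratic_generator_axioms \<iota> bar \<theta> q (- p)"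
    using gen tr nm \<delta> by unfold_locales auto
  moreover have "unramified_quadratic_axioms v \<iota> \<pi>"
    using assms(3) fld pi
    by (auto simp: unramified_quadratic_axioms_def unramified_field_extension_def Let_def)
  ultimately show ?thesis
    using assms(1,2)
    unfolding unramified_quadratic_def local_quadratic_generator_def quadratic_generator_def by blast
qed

theorem theorem4p11:
  fixes v :: "'k::field_char_0 \<Rightarrow> int"
    and \<iota> :: "'k \<Rightarrow> 'e::comm_ring_1"
    and bar :: "'e \<Rightarrow> 'e"
    and scale :: "'e \<Rightarrow> 'v::ab_group_add \<Rightarrow> 'v"
    and form :: "'v \<Rightarrow> 'v \<Rightarrow> 'e"
    and L :: "'v set"
  assumes "nonarch_local_field v"
    and "quadratic_algebra \<iota> bar"
    and "split_algebra \<iota> \<or> unramified_field_extension v \<iota>"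
    and "hermitian_space scale bar form"
    and "nondegenerate_on form UNIV"
    and "fg_submodule scale (integral_closure v \<iota>) L"
    and "nondegenerate_on form L"
  shows "carrier (lattice_unitary_group scale form L) = symmetry_subgroup scale bar form L"
  using assms(3)
proof
  assume "split_algebra \<iota>"
  then obtain e where "split_quadratic v \<iota> bar e"
    using split_quadratic_exists assms(1,2) by blast
  then interpret split_quadratic v \<iota> bar e .
  show ?thesis
    using generated_by_symmetries[OF assms(4) conjugation_order_split _ assms(5-7)]
      conjugation_order_whole_algebra e_idem bar_e by auto
next
  assume "unramified_field_extension v \<iota>"
  then obtain \<theta> t n \<pi> where "unramified_quadratic v \<iota> bar \<theta> t n \<pi>"
    using unramified_quadratic_exists assms(1,2) by blast
  then interpret unramified_quadratic v \<iota> bar \<theta> t n \<pi> .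
  show ?thesis
    using generated_by_symmetries[OF assms(4) conjugation_order_unramified _ assms(5-7)]
      conjugation_order_whole_algebra invertible by auto
qed

end
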